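(* Let $k\in\{1,\dots,n-1\}$ and let $H$ be an $(n-k)$-dimensional linear subspace of $\mathbb{R}^n$. Let $f:\mathbb{R}^n\to[0,\infty)$ be a bounded quasi-concave function such that $\mathrm{vol}_k\bigl(\mathcal{C}_t(f)\cap(x+H^\perp)\bigr)$, $x\in H$, attains its maximum at $x=0$ for every $t\in(0,1)$, and let $g:H\to[0,\infty)$ be a radially decreasing function. Then $$\int_Hg(x)\,P_Hf(x)\,dx\int_{H^\perp}f(y)\,dy\le\binom{n}{k}\|f\|_\infty\int_{\mathbb{R}^n}g(P_Hx)f(x)\,dx.$$
   Context: For a point $x$, $P_Hx$ denotes its orthogonal projection onto $H$; $H^\perp$ is the orthogonal complement of $H$. The projection function $P_Hf:H\to[0,\infty)$ of $f$ is $P_Hf(x)=\sup_{y\in H^\perp}f(x+y)$. $f$ is quasi-concave if $f((1-\lambda)x+\lambda y)\ge\min\{f(x),f(y)\}$ for all $x,y\in\mathbb{R}^n$ and $\lambda\in(0,1)$. $g$ is radially decreasing if $g(tx)\ge g(x)$ for all $t\in[0,1]$, $x\in H$. $\|f\|_\infty=\operatorname{ess\,sup}_{x\in\mathbb{R}^n}f(x)=\inf\{t\in\mathbb{R}:\mathrm{vol}(\{x\in\mathbb{R}^n:f(x)>t\})=0\}$ is the essential supremum, $\mathrm{supp}\,f$ is the closure of $\{x:f(x)>0\}$, and $\mathcal{C}_t(f)=\{x\in\mathrm{supp}\,f:f(x)\ge t\|f\|_\infty\}$. $\mathrm{vol}_k$ is $k$-dimensional Lebesgue measure and $\mathrm{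vol}=\mathrm{vol}_n$.
   Formalization: It is additionally assumed that f(x) ≤ ‖f‖_∞ for every x (f never exceeds its essential supremum, even on null sets), without which the inequality can fail, and that g is Lebesgue measurable on H so that the integrals are defined. *)

theory Defs
  imports "HOL-Analysis.Analysis" "HOL-Probability.Essential_Supremum"
begin

text \<open>
  Lebesgue measure on a linear subspace \<open>H\<close>, with underlying space \<open>H\<close>: the image of the product
  of one-dimensional Lebesgue measures under the coordinate map of an orthonormal basis of \<open>H\<close>,
  completed. This copies the library's construction of \<^term>\<open>lborel\<close> from \<^term>\<open>Basis\<close>.
  By rotation invariance the measure does not depend on which orthonormal basis is chosen.
  The completion matters: convex sets, hence quasi-concave functions, need not be Borel.
\<close>

definition orthonormal_basis :: "'a::euclidean_space set \<Rightarrow> 'a set \<Rightarrow> bool" where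
  "orthonormal_basis H B \<longleftrightarrow> pairwise orthogonal B \<and> (\<forall>b\<in>B. norm b = 1) \<and> span B = H"

definition subspace_lebesgue :: "'a::euclidean_space set \<Rightarrow> 'a measure" where
  "subspace_lebesgue H =
     (let B = (SOME B. orthonormal_basis H B)
      in completion (distr (\<Pi>\<^sub>M b\<in>B. (lborel :: real measure)) (restrict_space borel H)
                           (\<lambda>c. \<Sum>b\<in>B. c b *\<^sub>R b)))"

lemma orthonormal_basis_exists:
  assumes "subspace H"
  shows "\<exists>B. orthonormal_basis H B"
  using orthonormal_basis_subspace[OF assms] unfolding orthonormal_basis_def by metis

lemma space_subspace_lebesgue [simp]: "space (subspace_lebesgue H) = H"
  by (simp add: subspace_lebesgue_def Let_def space_restrict_space)

text \<open>
  The \<open>dim V\<close>-dimensional volume of the section of \<open>A\<close> by the affine subspace \<open>x + V\<close>,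
  which is translated back to \<open>V\<close> in order to be measured.
\<close>

definition section_vol :: "'a::euclidean_space set \<Rightarrow> 'a \<Rightarrow> 'a set \<Rightarrow> ennreal" where
  "section_vol V x A = emeasure (subspace_lebesgue V) ((\<lambda>z. z - x) ` (A \<inter> (+) x ` V))"

definition orth_proj :: "'a::euclidean_space set \<Rightarrow> 'a \<Rightarrow> 'a" where
  "orth_proj H x = (THE p. p \<in> H \<and> x - p \<in> H\<^sup>\<bottom>)"

definition proj_fun :: "'a::euclidean_space set \<Rightarrow> ('a \<Rightarrow> real) \<Rightarrow> 'a \<Rightarrow> real" where
  "proj_fun H f x = (SUP y\<in>H\<^sup>\<bottom>. f (x + y))"

definition quasi_concave :: "('a::real_vector \<Rightarrow> real) \<Rightarrow> bool" where
  "quasi_concave f \<longleftrightarrow>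
     (\<forall>x y. \<forall>u\<in>{0<..<1}. min (f x) (f y) \<le> f ((1 - u) *\<^sub>R x + u *\<^sub>R y))"

definition radially_decreasing_on :: "'a::real_vector set \<Rightarrow> ('a \<Rightarrow> real) \<Rightarrow> bool" where
  "radially_decreasing_on H g \<longleftrightarrow> (\<forall>x\<in>H. \<forall>t\<in>{0..1}. g x \<le> g (t *\<^sub>R x))"

definition ess_norm :: "('a::euclidean_space \<Rightarrow> real) \<Rightarrow> real" where
  "ess_norm f = Inf {t. emeasure lebesgue {x. f x > t} = 0}"

definition fun_supp :: "('a::topological_space \<Rightarrow> real) \<Rightarrow> 'a set" where
  "fun_supp f = closure {x. f x > 0}"

definition upper_level :: "('a::euclidean_space \<Rightarrow> real) \<Rightarrow> real \<Rightarrow> 'a set" where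
  "upper_level f t = {x \<in> fun_supp f. f x \<ge> t * ess_norm f}"

text \<open>Agreement with the library's essential supremum, which is extended-real valued here.\<close>

lemma ereal_ess_norm_eq_esssup:
  fixes f :: "'a::euclidean_space \<Rightarrow> real"
  assumes meas: "f \<in> borel_measurable lebesgue" and nn: "\<And>x. 0 \<le> f x"
    and bdd: "bounded (range f)"
  shows "ereal (ess_norm f) = esssup lebesgue (\<lambda>x. ereal (f x))"
proof -
  define S where "S = {t. emeasure lebesgue {x. f x > t} = 0}"
  obtain M where M: "\<And>x. f x \<le> M"
    using bdd unfolding bounded_iff by (metis rangeI real_norm_def abs_le_D1)
  have "{x. f x > M} = {}"
    using M by (auto simp: not_less)
  then have MS: "M \<in> S"
    by (simp add: S_def)
  have lb: "0 \<le> t" if "t \<in> S" for t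
  proof (rule ccontr)
    assume "\<not> 0 \<le> t"
    then have "{x. f x > t} = UNIV"
      using nn by (auto simp: not_le intro: less_le_trans)
    then show False
      using that by (simp add: S_def)
  qed
  have bdS: "bdd_below S"
    using lb by (auto simp: bdd_below_def)
  have "esssup lebesgue (\<lambda>x. ereal (f x)) = Inf {z. emeasure lebesgue {x. ereal (f x) > z} = 0}"
    using esssup_eq[of "\<lambda>x. ereal (f x)" lebesgue] meas by simp
  also have "\<dots> = ereal (Inf S)"
  proof (rule antisym)
    have le: "Inf {z. emeasure lebesgue {x. ereal (f x) > z} = 0} \<le> ereal t" if "t \<in> S" for t
      using that by (intro Inf_lower) (simp add: S_def)
    have "Inf {z. emeasure lebesgue {x. ereal (f x) > z} = 0} \<le> (INF t\<in>S. ereal t)"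
      using le by (intro INF_greatest)
    also have "\<dots> = ereal (Inf S)"
      using ereal_Inf'[OF bdS] MS by force
    finally show "Inf {z. emeasure lebesgue {x. ereal (f x) > z} = 0} \<le> ereal (Inf S)" .
  next
    show "ereal (Inf S) \<le> Inf {z. emeasure lebesgue {x. ereal (f x) > z} = 0}"
    proof (rule Inf_greatest)
      fix z assume z: "z \<in> {z. emeasure lebesgue {x. ereal (f x) > z} = 0}"
      show "ereal (Inf S) \<le> z"
      proof (cases z)
        case (real t)
        then have "t \<in> S" using z by (simp add: S_def)
        then show ?thesis using real cInf_lower[OF _ bdS] by simp
      qed (use z in auto)
    qed
  qed
  finally show ?thesis
    by (simp add: ess_norm_def S_def)
qed

end

theory Submission
  imports Defs
begin

text \<open>
  Write \<open>P\<close> for the orthogonal projection onto \<open>H\<close>, let \<open>d\<close> and \<open>k\<close> be the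
  dimensions of \<open>H\<close> and \<open>H\<^sup>\<bottom>\<close>, and let \<open>M\<close> be the essential supremum of \<open>f\<close>, so that \<open>0 \<le> f \<le> M\<close>.

  For a convex set \<open>K\<close> the inequality rests on one inclusion.  Let \<open>\<phi> x\<close> be the volume of the section
  of \<open>K\<close> over \<open>x \<in> H\<close>.  If some point of \<open>K\<close> lies over \<open>p\<close>, then by convexity the section over
  \<open>r p\<close> contains a translate of the section over \<open>0\<close> shrunk by \<open>1 - r\<close>, so
  \<open>\<phi> (r p) \<ge> (1 - r)\<^sup>k \<phi> 0\<close>.  In other words \<open>\<phi> \<ge> (1 - r)\<^sup>k \<phi> 0\<close> on \<open>r P(K)\<close>.  Averaging over \<open>r\<close> with
  the density \<open>k (1 - r)\<^bsup>k-1\<^esup>\<close>, whose integral over \<open>[s, 1]\<close> is \<open>(1 - s)\<^sup>k\<close>, turns this family of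
  bounds into \<open>\<phi> x \<ge> \<phi> 0 \<integral> k (1 - r)\<^bsup>k-1\<^esup> 1[x \<in> r P(K)] dr\<close>.  Integrate against the weight \<open>g\<close>: since \<open>g\<close> is
  radially decreasing, \<open>\<integral>\<close> of \<open>g\<close> over \<open>r P(K)\<close> is at least \<open>r\<^sup>d\<close> times its integral over \<open>P(K)\<close>,
  and the Beta integral \<open>\<integral> k (1 - r)\<^bsup>k-1\<^esup> r\<^sup>d dr\<close> is the reciprocal of the binomial
  coefficient \<open>d + k choose k\<close>.  This is lemma \<open>projection_section_inequality\<close>.

  For a function, apply the set inequality to every superlevel set \<open>{f > t}\<close>, whose projection is
  \<open>{P\<^sub>H f > t}\<close>, and integrate over \<open>t\<close>.  The right-hand sides add up to \<open>\<integral> g(P x) f(x) dx\<close>, and the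
  left-hand sides to \<open>\<integral>\<integral> g(x) min (P\<^sub>H f(x)) (f(y)) dy dx\<close>.  As both values lie in \<open>[0, M]\<close>, the
  elementary bound \<open>a b \<le> M min a b\<close> separates the variables.  This is lemma
  \<open>quasi_concave_projection_section_inequality\<close>.

  The remaining work is measure-theoretic: Lebesgue measure on \<open>H\<close> scales by \<open>r\<^sup>d\<close>, Lebesgue measure on
  the whole space is the product of those on \<open>H\<close> and \<open>H\<^sup>\<bottom>\<close>, and convex subsets of \<open>H\<close> are measurable.
\<close>

section \<open>Borel measure on a subspace\<close>

text \<open>
  The measure whose completion is \<^const>\<open>subspace_lebesgue\<close>, with the basis as an explicit parameter.
  Changes of variables and products are computed on the Borel sets, where continuity alone gives
  measurability; for a map into the completed space one also has to check that null sets pull back to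
  null sets.
\<close>
definition span_borel :: "'a::euclidean_space set \<Rightarrow> 'a measure" where
  "span_borel B = distr (\<Pi>\<^sub>M b\<in>B. (lborel :: real measure)) (restrict_space borel (span B))
                        (\<lambda>c. \<Sum>b\<in>B. c b *\<^sub>R b)"

lemma subspace_lebesgue_conv_span_borel:
  assumes "subspace H"
  obtains B where "orthonormal_basis H B" "subspace_lebesgue H = completion (span_borel B)"
proof -
  define B where "B = (SOME B. orthonormal_basis H B)"
  have B: "orthonormal_basis H B"
    unfolding B_def using orthonormal_basis_exists[OF assms] by (rule someI_ex)
  then have "span B = H"
    by (simp add: orthonormal_basis_def)
  then have "subspace_lebesgue H = completion (span_borel B)"
    unfolding subspace_lebesgue_def span_borel_def B_def [symmetric] Let_def by simp
  with B that show ?thesis by blast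
qed

context
  fixes H B :: "'a::euclidean_space set"
  assumes B: "orthonormal_basis H B"
begin

lemma orthonormal_basis_independent: "independent B"
  using B unfolding orthonormal_basis_def
  by (intro pairwise_orthogonal_independent) auto

lemma orthonormal_basis_finite: "finite B"
  using orthonormal_basis_independent independent_imp_finite by blast

lemma orthonormal_basis_card: "card B = dim H"
  using B orthonormal_basis_independent unfolding orthonormal_basis_def
  by (metis dim_span_eq_card_independent)

lemma orthonormal_basis_span: "span B = H"
  using B unfolding orthonormal_basis_def by blast

lemma orthonormal_basis_subset: "B \<subseteq> H"
  using B unfolding orthonormal_basis_def by (metis span_superset)

lemma orthonormal_basis_inner:
  "b \<in> B \<Longrightarrow> b' \<in> B \<Longrightarrow> b \<bullet> b' = (if b = b' then 1 else 0)"
  using B unfolding orthonormal_basis_def pairwise_def orthogonal_def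
  by (auto simp: dot_square_norm)

lemma orthonormal_basis_coord:
  assumes "b' \<in> B"
  shows "(\<Sum>b\<in>B. c b *\<^sub>R b) \<bullet> b' = c b'"
proof -
  have "(\<Sum>b\<in>B. c b *\<^sub>R b) \<bullet> b' = (\<Sum>b\<in>B. if b = b' then c b else 0)"
    unfolding inner_sum_left using assms by (intro sum.cong) (auto simp: orthonormal_basis_inner)
  then show ?thesis
    using assms orthonormal_basis_finite by simp
qed

lemma orthonormal_basis_sum_in: "(\<Sum>b\<in>B. c b *\<^sub>R b) \<in> H"
  unfolding orthonormal_basis_span [symmetric] by (intro span_sum span_scale span_base)

lemma orthonormal_basis_expand:
  assumes "x \<in> H"
  shows "(\<Sum>b\<in>B. (x \<bullet> b) *\<^sub>R b) = x"
proof -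
  obtain c where c: "x = (\<Sum>b\<in>B. c b *\<^sub>R b)"
    using assms orthonormal_basis_span span_finite[OF orthonormal_basis_finite] by auto
  show ?thesis
    unfolding c by (rule sum.cong[OF refl]) (simp only: orthonormal_basis_coord)
qed

lemma measurable_basis_sum:
  "(\<lambda>c. \<Sum>b\<in>B. c b *\<^sub>R b) \<in> (\<Pi>\<^sub>M b\<in>B. (lborel :: real measure)) \<rightarrow>\<^sub>M restrict_space borel (span B)"
proof (rule measurable_restrict_space2)
  show "(\<lambda>c. \<Sum>b\<in>B. c b *\<^sub>R b) \<in> space (\<Pi>\<^sub>M b\<in>B. (lborel :: real measure)) \<rightarrow> span B"
    unfolding orthonormal_basis_span using orthonormal_basis_sum_in by blast
  show "(\<lambda>c. \<Sum>b\<in>B. c b *\<^sub>R b) \<in> borel_measurable (\<Pi>\<^sub>M b\<in>B. (lborel :: real measure))"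
  proof (intro borel_measurable_sum borel_measurable_scaleR borel_measurable_const)
    fix b assume "b \<in> B"
    then have "(\<lambda>c. c b) \<in> (\<Pi>\<^sub>M b\<in>B. (lborel :: real measure)) \<rightarrow>\<^sub>M lborel"
      by (rule measurable_component_singleton)
    then show "(\<lambda>c. c b) \<in> borel_measurable (\<Pi>\<^sub>M b\<in>B. (lborel :: real measure))" by simp
  qed
qed

lemma space_span_borel: "space (span_borel B) = H"
  by (simp add: span_borel_def space_restrict_space orthonormal_basis_span)

lemma sets_span_borel: "sets (span_borel B) = sets (restrict_space borel H)"
  by (simp add: span_borel_def orthonormal_basis_span)

lemma measurable_span_borel_borel: "(\<lambda>x. x) \<in> span_borel B \<rightarrow>\<^sub>M borel"
  unfolding measurable_cong_sets[OF sets_span_borel refl]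
  by (intro measurable_restrict_space1) simp

lemma measurable_into_span_borel:
  "f \<in> M \<rightarrow>\<^sub>M borel \<Longrightarrow> (\<And>x. x \<in> space M \<Longrightarrow> f x \<in> H) \<Longrightarrow> f \<in> M \<rightarrow>\<^sub>M span_borel B"
  unfolding measurable_cong_sets[OF refl sets_span_borel]
  by (rule measurable_restrict_space2) blast+

lemma measurable_basis_coords:
  "(\<lambda>x. \<lambda>b\<in>B. x \<bullet> b) \<in> span_borel B \<rightarrow>\<^sub>M (\<Pi>\<^sub>M b\<in>B. (lborel :: real measure))"
proof (rule measurable_restrict)
  fix b
  have "(\<lambda>x. x \<bullet> b) \<in> span_borel B \<rightarrow>\<^sub>M borel"
    by (intro borel_measurable_inner measurable_span_borel_borel borel_measurable_const)
  then show "(\<lambda>x. x \<bullet> b) \<in> span_borel B \<rightarrow>\<^sub>M lborel" by simp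
qed

lemma nn_integral_span_borel:
  assumes "u \<in> borel_measurable (span_borel B)"
  shows "(\<integral>\<^sup>+x. u x \<partial>span_borel B)
           = (\<integral>\<^sup>+c. u (\<Sum>b\<in>B. c b *\<^sub>R b) \<partial>(\<Pi>\<^sub>M b\<in>B. (lborel :: real measure)))"
  using assms unfolding span_borel_def
  by (intro nn_integral_distr measurable_basis_sum) simp

lemma distr_basis_coords:
  "distr (span_borel B) (\<Pi>\<^sub>M b\<in>B. lborel) (\<lambda>x. \<lambda>b\<in>B. x \<bullet> b) = (\<Pi>\<^sub>M b\<in>B. (lborel :: real measure))"
proof -
  have "distr (span_borel B) (\<Pi>\<^sub>M b\<in>B. lborel) (\<lambda>x. \<lambda>b\<in>B. x \<bullet> b)
      = distr (\<Pi>\<^sub>M b\<in>B. lborel) (\<Pi>\<^sub>M b\<in>B. (lborel :: real measure)) (\<lambda>c. c)"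
    using measurable_basis_coords unfolding span_borel_def
    by (subst distr_distr[OF _ measurable_basis_sum], simp, intro distr_cong)
       (auto simp: fun_eq_iff orthonormal_basis_coord space_PiM PiE_def extensional_def)
  then show ?thesis by simp
qed

lemma sigma_finite_span_borel: "sigma_finite_measure (span_borel B)"
proof (rule sigma_finite_measure_distr)
  interpret product_sigma_finite "\<lambda>_. lborel :: real measure" ..
  interpret finite_product_sigma_finite "\<lambda>_. lborel :: real measure" B
    by standard (rule orthonormal_basis_finite)
  show "sigma_finite_measure (distr (span_borel B) (\<Pi>\<^sub>M b\<in>B. (lborel :: real measure)) (\<lambda>x. \<lambda>b\<in>B. x \<bullet> b))"
    unfolding distr_basis_coords by (rule sigma_finite_measure_axioms)
qed (rule measurable_basis_coords)

end

text \<open>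
  Scaling happens in each coordinate separately, so each of the \<open>card I\<close> factors contributes
  one \<open>\<bar>r\<bar>\<close>.
\<close>
lemma PiM_lborel_affine:
  assumes "finite I" "r \<noteq> 0"
  shows "density (distr (\<Pi>\<^sub>M i\<in>I. lborel) (\<Pi>\<^sub>M i\<in>I. lborel) (\<lambda>c. \<lambda>i\<in>I. t i + r * c i))
           (\<lambda>_. ennreal (\<bar>r\<bar> ^ card I)) = (\<Pi>\<^sub>M i\<in>I. (lborel :: real measure))"
proof -
  interpret product_sigma_finite "\<lambda>_. lborel :: real measure" ..
  have meas: "(\<lambda>c. \<lambda>i\<in>I. t i + r * c i) \<in> (\<Pi>\<^sub>M i\<in>I. (lborel :: real measure)) \<rightarrow>\<^sub>M (\<Pi>\<^sub>M i\<in>I. lborel)"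
    by (rule measurable_restrict) simp
  show ?thesis
  proof (rule PiM_eqI)
    fix A :: "_ \<Rightarrow> real set" assume A: "\<And>i. i \<in> I \<Longrightarrow> A i \<in> sets lborel"
    let ?A' = "\<lambda>i. (\<lambda>s. t i + r * s) -` A i"
    have A': "?A' i \<in> sets lborel" if "i \<in> I" for i
      using measurable_sets[of "\<lambda>s. t i + r * s" borel borel "A i"] A[OF that] by simp
    have one: "emeasure lborel (A i) = ennreal \<bar>r\<bar> * emeasure lborel (?A' i)" if "i \<in> I" for i
      using A[OF that] assms(2)
      by (subst lborel_real_affine[of r "t i"]) (auto simp: emeasure_density_const emeasure_distr)
    have "(\<lambda>c. \<lambda>i\<in>I. t i + r * c i) -` Pi\<^sub>E I A \<inter> space (\<Pi>\<^sub>M i\<in>I. (lborel :: real measure)) = Pi\<^sub>E I ?A'"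
      by (auto simp: space_PiM PiE_def Pi_def)
    moreover have "Pi\<^sub>E I A \<in> sets (\<Pi>\<^sub>M i\<in>I. (lborel :: real measure))"
      using assms(1) A by (intro sets_PiM_I_finite) auto
    ultimately have "emeasure (density (distr (\<Pi>\<^sub>M i\<in>I. lborel) (\<Pi>\<^sub>M i\<in>I. lborel) (\<lambda>c. \<lambda>i\<in>I. t i + r * c i))
           (\<lambda>_. ennreal (\<bar>r\<bar> ^ card I))) (Pi\<^sub>E I A) = ennreal (\<bar>r\<bar> ^ card I) * (\<Prod>i\<in>I. emeasure lborel (?A' i))"
      using meas assms(1) A' by (simp add: emeasure_density_const emeasure_distr emeasure_PiM)
    also have "\<dots> = (\<Prod>i\<in>I. emeasure lborel (A i))"
      by (simp add: one prod.distrib ennreal_power)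
    finally show "emeasure (density (distr (\<Pi>\<^sub>M i\<in>I. lborel) (\<Pi>\<^sub>M i\<in>I. lborel) (\<lambda>c. \<lambda>i\<in>I. t i + r * c i))
           (\<lambda>_. ennreal (\<bar>r\<bar> ^ card I))) (Pi\<^sub>E I A) = (\<Prod>i\<in>I. emeasure lborel (A i))" .
  qed (use assms in auto)
qed

lemma nn_integral_span_borel_affine:
  assumes B: "orthonormal_basis H B" and u: "u \<in> borel_measurable (span_borel B)"
    and a: "a \<in> H" and r: "r \<noteq> 0"
  shows "(\<integral>\<^sup>+x. u x \<partial>span_borel B) = ennreal (\<bar>r\<bar> ^ card B) * (\<integral>\<^sup>+x. u (a + r *\<^sub>R x) \<partial>span_borel B)"
proof -
  let ?P = "\<Pi>\<^sub>M b\<in>B. (lborel :: real measure)"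
  let ?s = "\<lambda>c. \<Sum>b\<in>B. c b *\<^sub>R b"
  let ?T = "\<lambda>c. \<lambda>b\<in>B. a \<bullet> b + r * c b"
  have us: "(\<lambda>c. u (?s c)) \<in> borel_measurable ?P"
    using measurable_basis_sum[OF B] u unfolding span_borel_def by (auto intro: measurable_compose)
  have "subspace H"
    using B subspace_span unfolding orthonormal_basis_def by blast
  then have aff: "(\<lambda>x. a + r *\<^sub>R x) \<in> span_borel B \<rightarrow>\<^sub>M span_borel B"
    by (intro measurable_into_span_borel[OF B] borel_measurable_add borel_measurable_scaleR
          measurable_span_borel_borel[OF B] measurable_const)
       (auto simp: space_span_borel[OF B] a subspace_add subspace_scale)
  have T: "?T \<in> ?P \<rightarrow>\<^sub>M ?P"
    by (rule measurable_restrict) simp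
  have sT: "?s (?T c) = a + r *\<^sub>R ?s c" for c
  proof -
    have "?s (?T c) = (\<Sum>b\<in>B. (a \<bullet> b) *\<^sub>R b + r *\<^sub>R (c b *\<^sub>R b))"
      by (rule sum.cong) (auto simp: scaleR_add_left)
    then show ?thesis
      using orthonormal_basis_expand[OF B a] by (simp add: sum.distrib scaleR_sum_right)
  qed
  have "(\<integral>\<^sup>+x. u x \<partial>span_borel B) = (\<integral>\<^sup>+c. u (?s c) \<partial>?P)"
    by (rule nn_integral_span_borel[OF B u])
  also have "\<dots> = (\<integral>\<^sup>+c. u (?s c) \<partial>density (distr ?P ?P ?T) (\<lambda>_. ennreal (\<bar>r\<bar> ^ card B)))"
    using PiM_lborel_affine[OF orthonormal_basis_finite[OF B] r, of "\<lambda>b. a \<bullet> b"] by simp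
  also have "\<dots> = ennreal (\<bar>r\<bar> ^ card B) * (\<integral>\<^sup>+c. u (?s (?T c)) \<partial>?P)"
    using us T by (subst nn_integral_density) (auto simp: nn_integral_cmult nn_integral_distr)
  also have "(\<integral>\<^sup>+c. u (?s (?T c)) \<partial>?P) = (\<integral>\<^sup>+x. u (a + r *\<^sub>R x) \<partial>span_borel B)"
    unfolding sT using nn_integral_span_borel[OF B measurable_compose[OF aff u]] by simp
  finally show ?thesis .
qed

section \<open>Splitting Lebesgue measure along a subspace and its complement\<close>

lemma nn_integral_lborel_translate:
  fixes u :: "'a::euclidean_space \<Rightarrow> ennreal"
  assumes "u \<in> borel_measurable borel"
  shows "(\<integral>\<^sup>+x. u (a + x) \<partial>lborel) = (\<integral>\<^sup>+x. u x \<partial>lborel)"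
proof -
  have "(\<integral>\<^sup>+x. u x \<partial>lborel) = (\<integral>\<^sup>+x. u x \<partial>distr lborel borel ((+) a))"
    by (simp only: lborel_distr_plus)
  also have "\<dots> = (\<integral>\<^sup>+x. u (a + x) \<partial>lborel)"
    using assms by (subst nn_integral_distr) auto
  finally show ?thesis ..
qed

text \<open>
  Uniqueness of Haar measure: applying Fubini to \<open>1\<^sub>B(y) 1\<^sub>A(x + y)\<close> and translating in each variable
  gives \<open>\<mu>(A) \<lambda>(B) = \<lambda>(A) \<mu>(-B)\<close>.  The unit ball serves as \<open>B\<close> because it is symmetric and because any
  measure obtained by rotating \<open>\<lambda>\<close> gives it the same volume, so that its mass fixes the constant.
\<close>
lemma translation_invariant_imp_lborel:
  fixes \<mu> :: "'a::euclidean_space measure"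
  assumes sets: "sets \<mu> = sets borel" and sf: "sigma_finite_measure \<mu>"
    and trans: "\<And>u a. u \<in> borel_measurable borel \<Longrightarrow> (\<integral>\<^sup>+x. u (a + x) \<partial>\<mu>) = (\<integral>\<^sup>+x. u x \<partial>\<mu>)"
    and ball: "emeasure \<mu> (ball 0 1) = emeasure lborel (ball (0::'a) 1)"
  shows "\<mu> = lborel"
proof (rule measure_eqI)
  fix A assume "A \<in> sets \<mu>"
  then have A [measurable]: "A \<in> sets borel" by (simp add: sets)
  interpret pair_sigma_finite \<mu> "lborel :: 'a measure"
    using sf by (intro pair_sigma_finite.intro lborel.sigma_finite_measure_axioms)
  let ?B = "ball (0::'a) 1"
  have prod_meas: "case_prod u \<in> borel_measurable (\<mu> \<Otimes>\<^sub>M lborel)"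
    if "case_prod u \<in> borel_measurable (borel \<Otimes>\<^sub>M borel)" for u :: "'a \<Rightarrow> 'a \<Rightarrow> ennreal"
    using that measurable_cong_sets[OF sets_pair_measure_cong[OF sets sets_lborel] refl] by blast
  have ind_meas: "(\<lambda>p. indicator S (h p) :: ennreal) \<in> borel_measurable (borel \<Otimes>\<^sub>M borel)"
    if "S \<in> sets borel" "h \<in> borel \<Otimes>\<^sub>M borel \<rightarrow>\<^sub>M borel"
    for S :: "'a set" and h :: "'a \<times> 'a \<Rightarrow> 'a"
    using that by (intro measurable_compose[OF _ borel_measurable_indicator])
  have shift_meas: "(\<lambda>p. snd p + fst p) \<in> borel \<Otimes>\<^sub>M borel \<rightarrow>\<^sub>M (borel :: 'a measure)"
    "(\<lambda>p. snd p - fst p) \<in> borel \<Otimes>\<^sub>M borel \<rightarrow>\<^sub>M (borel :: 'a measure)"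
    by (intro borel_measurable_add borel_measurable_diff measurable_fst measurable_snd)+
  have "emeasure \<mu> A * emeasure lborel ?B = (\<integral>\<^sup>+y. indicator ?B y * (\<integral>\<^sup>+x. indicator A x \<partial>\<mu>) \<partial>lborel)"
    by (subst nn_integral_multc) (simp_all add: sets mult.commute borel_measurable_indicator)
  also have "\<dots> = (\<integral>\<^sup>+y. (\<integral>\<^sup>+x. indicator ?B y * indicator A (y + x) \<partial>\<mu>) \<partial>lborel)"
  proof (rule nn_integral_cong)
    fix y :: 'a
    have "(\<lambda>x. indicator A (y + x) :: ennreal) \<in> borel_measurable \<mu>"
      unfolding measurable_cong_sets[OF sets refl] by measurable
    then show "indicator ?B y * (\<integral>\<^sup>+x. indicator A x \<partial>\<mu>)
             = (\<integral>\<^sup>+x. indicator ?B y * indicator A (y + x) \<partial>\<mu>)"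
      using trans[of "indicator A" y] by (simp add: nn_integral_cmult)
  qed
  also have "\<dots> = (\<integral>\<^sup>+x. (\<integral>\<^sup>+y. indicator ?B y * indicator A (y + x) \<partial>lborel) \<partial>\<mu>)"
    by (rule Fubini', rule prod_meas, unfold case_prod_unfold)
       (intro borel_measurable_times_ennreal ind_meas A shift_meas measurable_snd borel_open open_ball)
  also have "\<dots> = (\<integral>\<^sup>+x. (\<integral>\<^sup>+y. indicator ?B (y - x) * indicator A y \<partial>lborel) \<partial>\<mu>)"
  proof (rule nn_integral_cong)
    fix x :: 'a
    show "(\<integral>\<^sup>+y. indicator ?B y * indicator A (y + x) \<partial>lborel)
        = (\<integral>\<^sup>+y. (indicator ?B (y - x) * indicator A y :: ennreal) \<partial>lborel)"
    proof -
      have "(\<lambda>y. y - x) \<in> borel \<rightarrow>\<^sub>M borel" by simp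
      then have "(\<lambda>y. indicator ?B (y - x) :: ennreal) \<in> borel_measurable borel"
        by (rule measurable_compose) (simp add: borel_measurable_indicator)
      then have "(\<lambda>y. indicator ?B (y - x) * indicator A y :: ennreal) \<in> borel_measurable borel"
        by (intro borel_measurable_times_ennreal borel_measurable_indicator A)
      from nn_integral_lborel_translate[OF this, of x] show ?thesis
        by (simp add: add.commute)
    qed
  qed
  also have "\<dots> = (\<integral>\<^sup>+y. (\<integral>\<^sup>+x. indicator ?B (y - x) * indicator A y \<partial>\<mu>) \<partial>lborel)"
    by (rule Fubini'[symmetric], rule prod_meas, unfold case_prod_unfold)
       (intro borel_measurable_times_ennreal ind_meas A shift_meas measurable_snd borel_open open_ball)
  also have "\<dots> = (\<integral>\<^sup>+y. indicator A y * emeasure \<mu> ?B \<partial>lborel)"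
  proof (rule nn_integral_cong)
    fix y :: 'a
    have sym: "indicator ?B (y - x) = (indicator ?B (- y + x) :: ennreal)" for x
      by (auto simp: indicator_def norm_minus_commute)
    have "(\<lambda>x. - y + x) \<in> \<mu> \<rightarrow>\<^sub>M borel"
      unfolding measurable_cong_sets[OF sets refl] by simp
    then have m: "(\<lambda>x. indicator ?B (- y + x) :: ennreal) \<in> borel_measurable \<mu>"
      by (rule measurable_compose) (simp add: borel_measurable_indicator)
    have "(\<integral>\<^sup>+x. indicator ?B (y - x) * indicator A y \<partial>\<mu>) = (\<integral>\<^sup>+x. indicator ?B (- y + x) \<partial>\<mu>) * indicator A y"
      unfolding sym by (rule nn_integral_multc[OF m])
    also have "(\<integral>\<^sup>+x. indicator ?B (- y + x) \<partial>\<mu>) = emeasure \<mu> ?B"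
      using trans[of "indicator ?B" "- y"] by (simp add: sets borel_measurable_indicator)
    finally show "(\<integral>\<^sup>+x. indicator ?B (y - x) * indicator A y \<partial>\<mu>) = indicator A y * emeasure \<mu> ?B"
      by (simp add: mult.commute)
  qed
  also have "\<dots> = emeasure lborel A * emeasure lborel ?B"
    by (simp add: nn_integral_multc ball)
  finally have "emeasure \<mu> A * emeasure lborel ?B = emeasure lborel A * emeasure lborel ?B" .
  moreover have "emeasure lborel ?B \<noteq> 0"
    using open_not_negligible[of ?B]
    by (auto simp: negligible_iff_null_sets null_sets_def)
  moreover have "emeasure lborel ?B \<noteq> top"
    using emeasure_lborel_ball_finite[of "0::'a" 1] by simp
  ultimately show "emeasure \<mu> A = emeasure lborel A"
    by (metis ennreal_divide_times ennreal_divide_self mult.right_neutral ennreal_times_divide less_top zero_less_iff_neq_zero)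
qed (simp add: sets)

text \<open>
  Rotation invariance of Lebesgue measure, in the form that an arbitrary orthonormal basis \<open>E\<close>
  builds the same measure as the standard one.  The map \<open>S\<close> sending \<open>E\<close> to the standard basis
  transports one measure to the other and preserves the unit ball, so both give the ball the same mass
  and uniqueness of translation-invariant measures applies.
\<close>
lemma span_borel_UNIV_eq_lborel:
  fixes E :: "'a::euclidean_space set"
  assumes E: "orthonormal_basis UNIV E"
  shows "span_borel E = lborel"
proof (rule translation_invariant_imp_lborel)
  let ?M = "span_borel E"
  have fin: "finite E" by (rule orthonormal_basis_finite[OF E])
  show sets: "sets ?M = sets borel"
    using sets_span_borel[OF E] by simp
  show "sigma_finite_measure ?M"
    by (rule sigma_finite_span_borel[OF E])
  show "(\<integral>\<^sup>+x. u (a + x) \<partial>?M) = (\<integral>\<^sup>+x. u x \<partial>?M)" if "u \<in> borel_measurable borel" for u a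
  proof -
    have "u \<in> borel_measurable ?M"
      using that unfolding measurable_cong_sets[OF sets refl] .
    from nn_integral_span_borel_affine[OF E this, of a 1] show ?thesis by simp
  qed
  have "card (Basis :: 'a set) = card E"
    using orthonormal_basis_card[OF E] by simp
  then obtain \<pi> where \<pi>: "bij_betw \<pi> (Basis :: 'a set) E"
    using finite_same_card_bij[OF finite_Basis fin] by blast
  define S where "S = (\<lambda>y. \<Sum>i\<in>Basis. (y \<bullet> \<pi> i) *\<^sub>R (i::'a))"
  have S_inner: "S y \<bullet> i = y \<bullet> \<pi> i" if "i \<in> Basis" for y i
    using that by (simp add: S_def inner_sum_left inner_Basis if_distrib cong: if_cong)
  have "norm (S y) = norm y" for y
  proof -
    have "S y \<bullet> S y = (\<Sum>i\<in>Basis. (y \<bullet> \<pi> i) * (y \<bullet> \<pi> i))"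
      by (subst euclidean_inner) (simp add: S_inner)
    also have "\<dots> = (\<Sum>b\<in>E. (y \<bullet> b) * (y \<bullet> b))"
      by (rule sum.reindex_bij_betw[OF \<pi>, of "\<lambda>b. (y \<bullet> b) * (y \<bullet> b)"])
    also have "\<dots> = (\<Sum>b\<in>E. (y \<bullet> b) *\<^sub>R b) \<bullet> y"
      unfolding inner_sum_left inner_scaleR_left by (simp add: inner_commute)
    also have "\<dots> = y \<bullet> y"
      by (simp add: orthonormal_basis_expand[OF E])
    finally show ?thesis by (simp add: norm_eq_sqrt_inner)
  qed
  then have S_ball: "S -` ball 0 1 = ball 0 1" by auto
  have S_meas: "S \<in> ?M \<rightarrow>\<^sub>M borel"
    unfolding S_def measurable_cong_sets[OF sets refl] by measurable
  have "lborel = distr ?M borel S"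
  proof (rule lborel_eqI)
    fix l u :: 'a assume lu: "\<And>i. i \<in> Basis \<Longrightarrow> l \<bullet> i \<le> u \<bullet> i"
    interpret product_sigma_finite "\<lambda>_. lborel :: real measure" ..
    let ?P = "\<Pi>\<^sub>M b\<in>E. (lborel :: real measure)"
    let ?s = "\<lambda>c. \<Sum>b\<in>E. c b *\<^sub>R b"
    let ?\<rho> = "the_inv_into Basis \<pi>"
    let ?I = "\<lambda>b. {l \<bullet> ?\<rho> b <..< u \<bullet> ?\<rho> b}"
    have \<rho>: "?\<rho> (\<pi> i) = i" if "i \<in> Basis" for i
      using \<pi> that by (simp add: bij_betw_def the_inv_into_f_f)
    have \<pi>E: "\<pi> i \<in> E" if "i \<in> Basis" for i
      using \<pi> that by (auto simp: bij_betw_def)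
    have S_s: "S (?s c) \<in> box l u \<longleftrightarrow> (\<forall>b\<in>E. c b \<in> ?I b)" for c
    proof -
      have "S (?s c) \<in> box l u \<longleftrightarrow> (\<forall>i\<in>Basis. c (\<pi> i) \<in> {l \<bullet> i <..< u \<bullet> i})"
        by (simp add: mem_box S_inner orthonormal_basis_coord[OF E] \<pi>E)
      also have "\<dots> \<longleftrightarrow> (\<forall>i\<in>Basis. c (\<pi> i) \<in> ?I (\<pi> i))"
        using \<rho> by simp
      also have "\<dots> \<longleftrightarrow> (\<forall>b\<in>\<pi> ` Basis. c b \<in> ?I b)"
        by blast
      finally show ?thesis
        using bij_betw_imp_surj_on[OF \<pi>] by simp
    qed
    have "emeasure (distr ?M borel S) (box l u) = emeasure ?M (S -` box l u)"
      using S_meas by (subst emeasure_distr) (auto simp: space_span_borel[OF E])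
    also have "\<dots> = emeasure ?P (?s -` (S -` box l u) \<inter> space ?P)"
      unfolding span_borel_def
      using measurable_sets[OF S_meas, of "box l u"] measurable_basis_sum[OF E] sets
      by (intro emeasure_distr) (auto simp: span_borel_def space_restrict_space orthonormal_basis_span[OF E])
    also have "?s -` (S -` box l u) \<inter> space ?P = Pi\<^sub>E E ?I"
      using S_s by (auto simp: space_PiM PiE_def Pi_def)
    also have "emeasure ?P (Pi\<^sub>E E ?I) = (\<Prod>b\<in>E. emeasure lborel (?I b))"
      by (rule emeasure_PiM[OF fin]) simp
    also have "\<dots> = (\<Prod>i\<in>Basis. emeasure lborel (?I (\<pi> i)))"
      by (rule prod.reindex_bij_betw[OF \<pi>, symmetric])
    also have "\<dots> = (\<Prod>i\<in>Basis. ennreal ((u - l) \<bullet> i))"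
      by (rule prod.cong) (simp_all add: \<rho> lu inner_diff_left)
    also have "\<dots> = ennreal (\<Prod>i\<in>Basis. (u - l) \<bullet> i)"
      using lu by (intro prod_ennreal) (simp add: inner_diff_left)
    finally show "emeasure (distr ?M borel S) (box l u) = (\<Prod>i\<in>Basis. (u - l) \<bullet> i)" .
  qed simp
  then have "emeasure lborel (ball (0::'a) 1) = emeasure (distr ?M borel S) (ball 0 1)"
    by simp
  also have "\<dots> = emeasure ?M (ball 0 1)"
    using S_meas by (subst emeasure_distr) (auto simp: space_span_borel[OF E] S_ball)
  finally show "emeasure ?M (ball 0 1) = emeasure lborel (ball (0::'a) 1)"
    by (rule sym)
qed

lemma orthonormal_basis_Un_orthogonal_comp:
  assumes H: "subspace H" and B: "orthonormal_basis H B" and B': "orthonormal_basis (H\<^sup>\<bottom>) B'"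
  shows "orthonormal_basis UNIV (B \<union> B')" "B \<inter> B' = {}"
proof -
  have orth: "orthogonal b b'" if "b \<in> B" "b' \<in> B'" for b b'
    using that orthonormal_basis_subset[OF B] orthonormal_basis_subset[OF B']
    by (auto simp: orthogonal_comp_def)
  show "B \<inter> B' = {}"
  proof -
    have False if "b \<in> B" "b \<in> B'" for b
      using orth[OF that] that B unfolding orthonormal_basis_def by (auto simp: orthogonal_self)
    then show ?thesis by blast
  qed
  have "span (B \<union> B') = UNIV"
  proof -
    have "x \<in> span (B \<union> B')" for x
    proof -
      have "x \<in> H + H\<^sup>\<bottom>"
        using subspace_sum_orthogonal_comp[OF H] by simp
      then obtain y z where "x = y + z" "y \<in> H" "z \<in> H\<^sup>\<bottom>"
        by (rule set_plus_elim)
      moreover have "H \<subseteq> span (B \<union> B')" "H\<^sup>\<bottom> \<subseteq> span (B \<union> B')"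
        using orthonormal_basis_span[OF B] orthonormal_basis_span[OF B']
          span_mono[of B "B \<union> B'"] span_mono[of B' "B \<union> B'"] by auto
      ultimately show ?thesis by (auto intro: span_add)
    qed
    then show ?thesis by blast
  qed
  then show "orthonormal_basis UNIV (B \<union> B')"
    using B B' orth orth[THEN orthogonal_commute[THEN iffD1]]
    unfolding orthonormal_basis_def pairwise_def by blast
qed

text \<open>
  Together, orthonormal bases of \<open>H\<close> and of its complement form one of the whole space, so this
  is Fubini for the product over a disjoint union of index sets.
\<close>
lemma nn_integral_lborel_orthogonal_sum:
  fixes u :: "'a::euclidean_space \<Rightarrow> ennreal"
  assumes H: "subspace H" and B: "orthonormal_basis H B" and B': "orthonormal_basis (H\<^sup>\<bottom>) B'"
    and u: "u \<in> borel_measurable borel"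
  shows "(\<integral>\<^sup>+x. u x \<partial>lborel) = (\<integral>\<^sup>+x. (\<integral>\<^sup>+y. u (x + y) \<partial>span_borel B') \<partial>span_borel B)"
proof -
  interpret product_sigma_finite "\<lambda>_. lborel :: real measure" ..
  note E = orthonormal_basis_Un_orthogonal_comp[OF H B B']
  note fin = orthonormal_basis_finite[OF B] orthonormal_basis_finite[OF B']
  let ?P = "\<lambda>I. \<Pi>\<^sub>M b\<in>I. (lborel :: real measure)"
  let ?s = "\<lambda>I c. \<Sum>b\<in>I. c b *\<^sub>R (b::'a)"
  have M: "span_borel (B \<union> B') = lborel"
    by (rule span_borel_UNIV_eq_lborel[OF E(1)])
  have uM: "u \<in> borel_measurable (span_borel (B \<union> B'))"
    using u by (simp add: M)
  have us: "(\<lambda>c. u (?s (B \<union> B') c)) \<in> borel_measurable (?P (B \<union> B'))"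
    using measurable_basis_sum[OF E(1)] uM unfolding span_borel_def by (auto intro: measurable_compose)
  have add_meas: "(\<lambda>y. u (x + y)) \<in> borel_measurable (span_borel B')" for x
    by (rule measurable_compose[OF _ u])
       (intro borel_measurable_add measurable_const measurable_span_borel_borel[OF B']; simp)
  interpret M': sigma_finite_measure "span_borel B'"
    by (rule sigma_finite_span_borel[OF B'])
  have "(\<lambda>p. fst p + snd p) \<in> span_borel B \<Otimes>\<^sub>M span_borel B' \<rightarrow>\<^sub>M borel"
    by (intro borel_measurable_add measurable_compose[OF measurable_fst] measurable_compose[OF measurable_snd]
          measurable_span_borel_borel[OF B] measurable_span_borel_borel[OF B'])
  then have "(\<lambda>p. u (fst p + snd p)) \<in> borel_measurable (span_borel B \<Otimes>\<^sub>M span_borel B')"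
    by (rule measurable_compose[OF _ u])
  then have inner_meas: "(\<lambda>x. \<integral>\<^sup>+y. u (x + y) \<partial>span_borel B') \<in> borel_measurable (span_borel B)"
    by (intro M'.borel_measurable_nn_integral) (simp add: case_prod_unfold)
  have "(\<integral>\<^sup>+x. u x \<partial>lborel) = (\<integral>\<^sup>+c. u (?s (B \<union> B') c) \<partial>?P (B \<union> B'))"
    using nn_integral_span_borel[OF E(1) uM] M by simp
  also have "\<dots> = (\<integral>\<^sup>+c. (\<integral>\<^sup>+d. u (?s (B \<union> B') (merge B B' (c, d))) \<partial>?P B') \<partial>?P B)"
    by (rule product_nn_integral_fold[OF E(2) fin us])
  also have "\<dots> = (\<integral>\<^sup>+c. (\<integral>\<^sup>+d. u (?s B c + ?s B' d) \<partial>?P B') \<partial>?P B)"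
  proof -
    have "?s (B \<union> B') (merge B B' (c, d)) = ?s B c + ?s B' d" for c d
    proof -
      have "?s (B \<union> B') (merge B B' (c, d)) = ?s B (merge B B' (c, d)) + ?s B' (merge B B' (c, d))"
        by (rule sum.union_disjoint[OF fin E(2)])
      also have "?s B (merge B B' (c, d)) = ?s B c"
        by (rule sum.cong) (auto simp: merge_def)
      also have "?s B' (merge B B' (c, d)) = ?s B' d"
        using E(2) by (intro sum.cong) (auto simp: merge_def)
      finally show ?thesis .
    qed
    then show ?thesis by simp
  qed
  also have "\<dots> = (\<integral>\<^sup>+c. (\<integral>\<^sup>+y. u (?s B c + y) \<partial>span_borel B') \<partial>?P B)"
    using nn_integral_span_borel[OF B' add_meas] by simp
  also have "\<dots> = (\<integral>\<^sup>+x. (\<integral>\<^sup>+y. u (x + y) \<partial>span_borel B') \<partial>span_borel B)"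
    by (rule nn_integral_span_borel[OF B inner_meas, symmetric])
  finally show ?thesis .
qed

section \<open>Passing to the completed measures\<close>

lemma sigma_finite_measure_completion:
  assumes "sigma_finite_measure M"
  shows "sigma_finite_measure (completion M)"
proof -
  interpret sigma_finite_measure M by fact
  obtain A where A: "countable A" "A \<subseteq> sets M" "\<Union>A = space M" "\<forall>a\<in>A. emeasure M a \<noteq> \<infinity>"
    using sigma_finite_countable by blast
  then have "\<forall>a\<in>A. emeasure (completion M) a \<noteq> \<infinity>" "A \<subseteq> sets (completion M)"
    by (auto simp: subset_iff)
  with A(1,3) show ?thesis
    by (intro sigma_finite_measure.intro) auto
qed

lemma sigma_finite_subspace_lebesgue:
  "subspace H \<Longrightarrow> sigma_finite_measure (subspace_lebesgue H)"
  by (metis sigma_finite_measure_completion sigma_finite_span_borel subspace_lebesgue_conv_span_borel)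

lemma nn_integral_subspace_lebesgue_affine:
  assumes H: "subspace H" and u: "u \<in> borel_measurable (subspace_lebesgue H)"
    and a: "a \<in> H" and r: "r \<noteq> 0"
  shows "(\<integral>\<^sup>+x. u x \<partial>subspace_lebesgue H)
           = ennreal (\<bar>r\<bar> ^ dim H) * (\<integral>\<^sup>+x. u (a + r *\<^sub>R x) \<partial>subspace_lebesgue H)"
proof -
  obtain B where B: "orthonormal_basis H B" and sB: "subspace_lebesgue H = completion (span_borel B)"
    using subspace_lebesgue_conv_span_borel[OF H] .
  let ?M = "span_borel B"
  obtain v where v: "v \<in> borel_measurable ?M" "AE x in ?M. u x = v x"
    using completion_ex_borel_measurable u unfolding sB by blast
  from v(2) obtain N where N: "\<And>x. x \<in> space ?M - N \<Longrightarrow> u x = v x" "N \<in> null_sets ?M"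
    by (rule AE_E3) blast
  have aff: "(\<lambda>x. a + r *\<^sub>R x) \<in> ?M \<rightarrow>\<^sub>M ?M"
    by (intro measurable_into_span_borel[OF B] borel_measurable_add borel_measurable_scaleR
          measurable_span_borel_borel[OF B] measurable_const)
       (auto simp: space_span_borel[OF B] a H subspace_add subspace_scale)
  have "0 = (\<integral>\<^sup>+x. indicator N x \<partial>?M)"
    using N(2) by (simp add: nn_integral_indicator null_sets_def)
  also have "\<dots> = ennreal (\<bar>r\<bar> ^ card B) * (\<integral>\<^sup>+x. indicator N (a + r *\<^sub>R x) \<partial>?M)"
    using N(2) by (intro nn_integral_span_borel_affine[OF B _ a r] borel_measurable_indicator) auto
  finally have "(\<integral>\<^sup>+x. indicator N (a + r *\<^sub>R x) \<partial>?M) = 0"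
    using r by simp
  moreover have "(\<lambda>x. indicator N (a + r *\<^sub>R x) :: ennreal) \<in> borel_measurable ?M"
    using N(2) by (intro measurable_compose[OF aff] borel_measurable_indicator) auto
  ultimately have "AE x in ?M. indicator N (a + r *\<^sub>R x) = (0::ennreal)"
    by (subst (asm) nn_integral_0_iff_AE)
  then have ae: "AE x in ?M. u (a + r *\<^sub>R x) = v (a + r *\<^sub>R x)"
  proof (rule AE_mp, rule_tac AE_I2, rule_tac impI)
    fix x assume "x \<in> space ?M" "indicator N (a + r *\<^sub>R x) = (0::ennreal)"
    then show "u (a + r *\<^sub>R x) = v (a + r *\<^sub>R x)"
      using measurable_space[OF aff] by (intro N(1)) (auto simp: indicator_def split: if_splits)
  qed
  have "(\<integral>\<^sup>+x. u x \<partial>?M) = (\<integral>\<^sup>+x. v x \<partial>?M)"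
    by (rule nn_integral_cong_AE[OF v(2)])
  also have "\<dots> = ennreal (\<bar>r\<bar> ^ card B) * (\<integral>\<^sup>+x. v (a + r *\<^sub>R x) \<partial>?M)"
    by (rule nn_integral_span_borel_affine[OF B v(1) a r])
  also have "(\<integral>\<^sup>+x. v (a + r *\<^sub>R x) \<partial>?M) = (\<integral>\<^sup>+x. u (a + r *\<^sub>R x) \<partial>?M)"
    using ae by (intro nn_integral_cong_AE) auto
  finally show ?thesis
    by (simp add: sB nn_integral_completion orthonormal_basis_card[OF B])
qed

text \<open>
  Fubini for the indicator of \<open>N\<close>.  The consequence that almost all fibres are null lets Fubini extend from Borel functions to Lebesgue
  measurable ones, whose restriction to an individual fibre need not be measurable.
\<close>
lemma AE_lborel_imp_AE_orthogonal_sum: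
  fixes N :: "'a::euclidean_space set"
  assumes H: "subspace H" and B: "orthonormal_basis H B" and B': "orthonormal_basis (H\<^sup>\<bottom>) B'"
    and N: "N \<in> null_sets lborel"
  shows "AE x in span_borel B. AE y in span_borel B'. x + y \<notin> N"
proof -
  interpret M': sigma_finite_measure "span_borel B'"
    by (rule sigma_finite_span_borel[OF B'])
  have N': "N \<in> sets borel" using N by auto
  have "(\<lambda>p. fst p + snd p) \<in> span_borel B \<Otimes>\<^sub>M span_borel B' \<rightarrow>\<^sub>M borel"
    by (intro borel_measurable_add measurable_compose[OF measurable_fst] measurable_compose[OF measurable_snd]
          measurable_span_borel_borel[OF B] measurable_span_borel_borel[OF B'])
  then have ind2: "(\<lambda>p. indicator N (fst p + snd p) :: ennreal) \<in> borel_measurable (span_borel B \<Otimes>\<^sub>M span_borel B')"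
    by (rule measurable_compose) (intro borel_measurable_indicator N')
  have "(\<lambda>y. x + y) \<in> span_borel B' \<rightarrow>\<^sub>M borel" for x
    by (intro borel_measurable_add measurable_const measurable_span_borel_borel[OF B']; simp)
  then have ind1: "(\<lambda>y. indicator N (x + y) :: ennreal) \<in> borel_measurable (span_borel B')" for x
    by (rule measurable_compose) (intro borel_measurable_indicator N')
  have "(\<integral>\<^sup>+x. (\<integral>\<^sup>+y. indicator N (x + y) \<partial>span_borel B') \<partial>span_borel B) = (\<integral>\<^sup>+x. indicator N x \<partial>lborel)"
    using N' by (intro nn_integral_lborel_orthogonal_sum[OF H B B', symmetric] borel_measurable_indicator)
  also have "\<dots> = 0"
    using N by (simp add: null_sets_def)
  finally have "AE x in span_borel B. (\<integral>\<^sup>+y. indicator N (x + y) \<partial>span_borel B') = 0"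
    using ind2 by (subst (asm) nn_integral_0_iff_AE)
      (auto intro!: M'.borel_measurable_nn_integral simp: case_prod_unfold)
  then show ?thesis
  proof (rule AE_mp, rule_tac AE_I2, rule_tac impI)
    fix x assume "(\<integral>\<^sup>+y. indicator N (x + y) \<partial>span_borel B') = 0"
    then have "AE y in span_borel B'. indicator N (x + y) = (0::ennreal)"
      using ind1[of x] by (subst (asm) nn_integral_0_iff_AE)
    then show "AE y in span_borel B'. x + y \<notin> N"
      by (rule AE_mp) (auto simp: indicator_def intro!: AE_I2)
  qed
qed

lemma nn_integral_lebesgue_orthogonal_sum:
  fixes u :: "'a::euclidean_space \<Rightarrow> ennreal"
  assumes H: "subspace H" and u: "u \<in> borel_measurable lebesgue"
  shows "(\<integral>\<^sup>+x. u x \<partial>lebesgue)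
           = (\<integral>\<^sup>+x. (\<integral>\<^sup>+y. u (x + y) \<partial>subspace_lebesgue (H\<^sup>\<bottom>)) \<partial>subspace_lebesgue H)"
proof -
  obtain B where B: "orthonormal_basis H B" and sB: "subspace_lebesgue H = completion (span_borel B)"
    using subspace_lebesgue_conv_span_borel[OF H] .
  obtain B' where B': "orthonormal_basis (H\<^sup>\<bottom>) B'"
    and sB': "subspace_lebesgue (H\<^sup>\<bottom>) = completion (span_borel B')"
    using subspace_lebesgue_conv_span_borel[OF subspace_orthogonal_comp] .
  obtain v where v: "v \<in> borel_measurable lborel" "AE x in lborel. u x = v x"
    using completion_ex_borel_measurable[OF u] by blast
  from v(2) obtain N where N: "\<And>x. x \<in> space lborel - N \<Longrightarrow> u x = v x" "N \<in> null_sets lborel"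
    by (rule AE_E3) blast
  have "(\<integral>\<^sup>+x. u x \<partial>lebesgue) = (\<integral>\<^sup>+x. v x \<partial>lborel)"
    unfolding nn_integral_completion by (rule nn_integral_cong_AE[OF v(2)])
  also have "\<dots> = (\<integral>\<^sup>+x. (\<integral>\<^sup>+y. v (x + y) \<partial>span_borel B') \<partial>span_borel B)"
    using v(1) by (intro nn_integral_lborel_orthogonal_sum[OF H B B']) simp
  also have "\<dots> = (\<integral>\<^sup>+x. (\<integral>\<^sup>+y. u (x + y) \<partial>span_borel B') \<partial>span_borel B)"
  proof (rule nn_integral_cong_AE)
    show "AE x in span_borel B. (\<integral>\<^sup>+y. v (x + y) \<partial>span_borel B') = (\<integral>\<^sup>+y. u (x + y) \<partial>span_borel B')"
      using AE_lborel_imp_AE_orthogonal_sum[OF H B B' N(2)]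
    proof (rule AE_mp, rule_tac AE_I2, rule_tac impI)
      fix x assume "AE y in span_borel B'. x + y \<notin> N"
      then show "(\<integral>\<^sup>+y. v (x + y) \<partial>span_borel B') = (\<integral>\<^sup>+y. u (x + y) \<partial>span_borel B')"
        using N(1) by (intro nn_integral_cong_AE) (erule AE_mp, auto intro!: AE_I2)
    qed
  qed
  finally show ?thesis
    by (simp add: sB sB' nn_integral_completion)
qed

lemma convex_imp_sets_lebesgue:
  fixes C :: "'a::euclidean_space set"
  assumes "convex C"
  shows "C \<in> sets lebesgue"
proof -
  have "C = interior C \<union> (C \<inter> frontier C)"
    using interior_subset closure_subset by (auto simp: frontier_def)
  moreover have "negligible (C \<inter> frontier C)"
    using negligible_convex_frontier[OF assms] by (rule negligible_subset) blast
  then have "C \<inter> frontier C \<in> sets lebesgue"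
    by (simp add: negligible_imp_sets)
  moreover have "interior C \<in> sets lebesgue"
    by (simp add: borel_open)
  ultimately show ?thesis
    by (metis sets.Un)
qed

section \<open>The orthogonal projection and measurability of convex sets\<close>

lemma orth_proj_add:
  fixes H :: "'a::euclidean_space set"
  assumes H: "subspace H" and x: "x \<in> H" and y: "y \<in> H\<^sup>\<bottom>"
  shows "orth_proj H (x + y) = x"
  unfolding orth_proj_def
proof (rule the_equality)
  show "x \<in> H \<and> x + y - x \<in> H\<^sup>\<bottom>" using x y by simp
  fix p assume p: "p \<in> H \<and> x + y - p \<in> H\<^sup>\<bottom>"
  then have "x - p \<in> H" using H x by (simp add: subspace_diff)
  moreover have "x - p \<in> H\<^sup>\<bottom>"
    using subspace_diff[OF subspace_orthogonal_comp, of "x + y - p" H y] p y by (simp add: algebra_simps)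
  ultimately have "orthogonal (x - p) (x - p)"
    unfolding orthogonal_comp_def by blast
  then show "p = x" by (simp add: orthogonal_self)
qed

lemma orthogonal_sum_exists:
  fixes H :: "'a::euclidean_space set"
  assumes "subspace H"
  obtains y z where "x = y + z" "y \<in> H" "z \<in> H\<^sup>\<bottom>"
  using subspace_sum_orthogonal_comp[OF assms] by (metis UNIV_I set_plus_elim)

lemma orth_proj_in:
  "subspace H \<Longrightarrow> orth_proj H x \<in> H"
  by (metis orth_proj_add orthogonal_sum_exists)

lemma orth_proj_residual:
  "subspace H \<Longrightarrow> x - orth_proj H x \<in> H\<^sup>\<bottom>"
  by (metis add_diff_cancel_left' orth_proj_add orthogonal_sum_exists)

lemma linear_orth_proj:
  assumes "subspace H"
  shows "linear (orth_proj H)"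
proof (rule linearI)
  note V = assms subspace_orthogonal_comp[of H]
  fix x y c
  have "orth_proj H ((orth_proj H x + orth_proj H y) + ((x - orth_proj H x) + (y - orth_proj H y)))
      = orth_proj H x + orth_proj H y"
    by (intro orth_proj_add subspace_add V orth_proj_in orth_proj_residual)
  then show "orth_proj H (x + y) = orth_proj H x + orth_proj H y"
    by (simp add: algebra_simps)
  have "orth_proj H (c *\<^sub>R orth_proj H x + c *\<^sub>R (x - orth_proj H x)) = c *\<^sub>R orth_proj H x"
    by (intro orth_proj_add subspace_scale V orth_proj_in orth_proj_residual)
  then show "orth_proj H (c *\<^sub>R x) = c *\<^sub>R orth_proj H x"
    by (simp add: algebra_simps)
qed

lemma borel_measurable_orth_proj:
  "subspace H \<Longrightarrow> orth_proj H \<in> borel_measurable borel"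
  using linear_orth_proj linear_continuous_on linear_conv_bounded_linear borel_measurable_continuous_onI by blast

text \<open>
  For the completed measure on \<open>H\<close> Borel measurability is not enough: null sets must pull back to null
  sets.  They do, since the preimage of \<open>N\<close> is the product of \<open>N\<close> with the orthogonal complement.
\<close>
lemma measurable_orth_proj_lebesgue:
  assumes H: "subspace H"
  shows "orth_proj H \<in> lebesgue \<rightarrow>\<^sub>M subspace_lebesgue H"
proof -
  obtain B where B: "orthonormal_basis H B" and sB: "subspace_lebesgue H = completion (span_borel B)"
    using subspace_lebesgue_conv_span_borel[OF H] .
  obtain B' where B': "orthonormal_basis (H\<^sup>\<bottom>) B'"
    using orthonormal_basis_exists[OF subspace_orthogonal_comp] by blast
  have P: "orth_proj H \<in> lborel \<rightarrow>\<^sub>M span_borel B"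
    using borel_measurable_orth_proj[OF H] orth_proj_in[OF H]
    by (intro measurable_into_span_borel[OF B]) simp_all
  show ?thesis
    unfolding sB
  proof (rule completion.measurable_completion2)
    show P': "orth_proj H \<in> lebesgue \<rightarrow>\<^sub>M span_borel B"
      by (rule measurable_completion[OF P])
    show "null_sets (span_borel B) \<subseteq> null_sets (distr lebesgue (span_borel B) (orth_proj H))"
    proof
      fix N assume N: "N \<in> null_sets (span_borel B)"
      then have Ns: "N \<in> sets (span_borel B)" by blast
      have N': "orth_proj H -` N \<in> sets borel"
        using measurable_sets[OF P Ns] by simp
      have "emeasure lborel (orth_proj H -` N) = (\<integral>\<^sup>+x. indicator (orth_proj H -` N) x \<partial>lborel)"
        using N' by simp
      also have "\<dots> = (\<integral>\<^sup>+x. (\<integral>\<^sup>+y. indicator (orth_proj H -` N) (x + y) \<partial>span_borel B') \<partial>span_borel B)"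
        by (intro nn_integral_lborel_orthogonal_sum[OF H B B'] borel_measurable_indicator N')
      also have "\<dots> = (\<integral>\<^sup>+x. (\<integral>\<^sup>+y. indicator N x \<partial>span_borel B') \<partial>span_borel B)"
        by (intro nn_integral_cong)
           (simp add: space_span_borel[OF B] space_span_borel[OF B'] orth_proj_add[OF H] indicator_def)
      also have "\<dots> = 0"
        using N Ns by (simp add: nn_integral_multc null_sets_def)
      finally show "N \<in> null_sets (distr lebesgue (span_borel B) (orth_proj H))"
        using N' Ns P' by (intro null_setsI) (simp_all add: emeasure_distr)
    qed
  qed
qed

text \<open>
  Null frontiers make convex sets measurable in the full space.  To descend to \<open>H\<close>, the set \<open>C\<close> is
  thickened to the convex cylinder over it, which is Borel up to a null set; almost every
  translate of \<open>H\<close> meets that null set in a null set, and any such translate meets the cylinder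
  in a copy of \<open>C\<close>.
\<close>
lemma convex_imp_sets_subspace_lebesgue:
  fixes C :: "'a::euclidean_space set"
  assumes H: "subspace H" and C: "convex C" "C \<subseteq> H"
  shows "C \<in> sets (subspace_lebesgue H)"
proof -
  obtain B where B: "orthonormal_basis H B" and sB: "subspace_lebesgue H = completion (span_borel B)"
    using subspace_lebesgue_conv_span_borel[OF H] .
  then have B2: "orthonormal_basis (H\<^sup>\<bottom>\<^sup>\<bottom>) B"
    by (simp add: orthogonal_comp_self[OF H])
  obtain B' where B': "orthonormal_basis (H\<^sup>\<bottom>) B'"
    using orthonormal_basis_exists[OF subspace_orthogonal_comp] by blast
  note H' = subspace_orthogonal_comp[of H]
  have "convex (orth_proj H -` C)"
    by (rule convex_linear_vimage[OF linear_orth_proj[OF H] C(1)])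
  then have "orth_proj H -` C \<in> sets lebesgue"
    by (rule convex_imp_sets_lebesgue)
  then obtain S N N' where SN: "orth_proj H -` C = S \<union> N" "N \<subseteq> N'" "N' \<in> null_sets lborel" "S \<in> sets lborel"
    by (rule sets_completionE)
  have ae: "AE y in span_borel B'. AE x in span_borel B. y + x \<notin> N'"
    by (rule AE_lborel_imp_AE_orthogonal_sum[OF H' B' B2 SN(3)])
  have "\<exists>y\<in>H\<^sup>\<bottom>. AE x in span_borel B. y + x \<notin> N'"
  proof (rule ccontr)
    assume "\<not> ?thesis"
    with ae have ae_False: "AE y in span_borel B'. False"
      by (rule_tac AE_mp[OF ae]) (auto simp: space_span_borel[OF B'] intro!: AE_I2)
    have "emeasure lborel (UNIV :: 'a set) = (\<integral>\<^sup>+x. 1 \<partial>(lborel :: 'a measure))"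
      by simp
    also have "\<dots> = (\<integral>\<^sup>+y. (\<integral>\<^sup>+x. 1 \<partial>span_borel B) \<partial>span_borel B')"
      by (rule nn_integral_lborel_orthogonal_sum[OF H' B' B2]) simp
    also have "\<dots> = (\<integral>\<^sup>+y. 0 \<partial>span_borel B')"
      using ae_False by (intro nn_integral_cong_AE) auto
    finally show False by simp
  qed
  then obtain y where y: "y \<in> H\<^sup>\<bottom>" "AE x in span_borel B. y + x \<notin> N'" by blast
  have tr: "(\<lambda>x. y + x) \<in> span_borel B \<rightarrow>\<^sub>M borel"
    by (intro borel_measurable_add measurable_const measurable_span_borel_borel[OF B]; simp)
  have sec: "{x\<in>H. y + x \<in> D} \<in> sets (span_borel B)" if "D \<in> sets borel" for D
    using measurable_sets[OF tr that] by (simp add: space_span_borel[OF B] vimage_def Int_def conj_commute)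
  show ?thesis
    unfolding sB
  proof (rule sets_completionI)
    have "x \<in> C \<longleftrightarrow> y + x \<in> S \<union> N" if "x \<in> H" for x
      using orth_proj_add[OF H that y(1)] SN(1) by (metis add.commute vimage_eq)
    then show "C = {x\<in>H. y + x \<in> S} \<union> {x\<in>H. y + x \<in> N}"
      using C(2) by blast
    show "{x\<in>H. y + x \<in> N} \<subseteq> {x\<in>H. y + x \<in> N'}"
      using SN(2) by blast
    show "{x\<in>H. y + x \<in> N'} \<in> null_sets (span_borel B)"
      using y(2) SN(3) sec by (subst (asm) AE_iff_null) (auto simp: space_span_borel[OF B])
    show "{x\<in>H. y + x \<in> S} \<in> sets (span_borel B)"
      using SN(4) sec by simp
  qed
qed

section \<open>The Beta integral and the averaging weight\<close>

text \<open>Integration by parts lowers the exponent \<open>m\<close> at the cost of raising \<open>d\<close>.\<close>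
lemma has_integral_Beta_nat:
  "((\<lambda>x::real. x ^ d * (1 - x) ^ m) has_integral (fact d * fact m / fact (d + m + 1))) {0..1}"
proof (induction m arbitrary: d)
  case 0
  have "((\<lambda>x::real. x ^ d) has_integral (1 ^ Suc d / real (Suc d) - 0 ^ Suc d / real (Suc d))) {0..1}"
  proof (intro fundamental_theorem_of_calculus)
    fix x :: real
    have "((\<lambda>x. x ^ Suc d / real (Suc d)) has_real_derivative (real (Suc d) * x ^ d / real (Suc d)))
        (at x within {0..1})"
      using DERIV_pow[of "Suc d" x] by (intro DERIV_cdivide) (simp del: of_nat_Suc power_Suc)
    then show "((\<lambda>x. x ^ Suc d / real (Suc d)) has_vector_derivative x ^ d) (at x within {0..1})"
      by (simp del: of_nat_Suc power_Suc flip: has_real_derivative_iff_has_vector_derivative)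
  qed simp
  then show ?case by simp
next
  case (Suc m)
  let ?F = "\<lambda>x::real. x ^ Suc d * (1 - x) ^ Suc m"
  let ?F' = "\<lambda>x::real. real (Suc d) * (x ^ d * (1 - x) ^ Suc m) - real (Suc m) * (x ^ Suc d * (1 - x) ^ m)"
  have "(?F' has_integral (?F 1 - ?F 0)) {0..1}"
  proof (intro fundamental_theorem_of_calculus)
    fix x :: real
    have "(?F has_real_derivative
        (real (Suc d) * x ^ d * (1 - x) ^ Suc m + x ^ Suc d * (real (Suc m) * (1 - x) ^ m * - 1))) (at x within {0..1})"
      by (rule derivative_eq_intros refl | simp)+
    then show "(?F has_vector_derivative ?F' x) (at x within {0..1})"
      by (simp add: algebra_simps flip: has_real_derivative_iff_has_vector_derivative)
  qed simp
  then have "(?F' has_integral 0) {0..1}" by simp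
  from has_integral_add[OF this has_integral_mult_right[OF Suc.IH[of "Suc d"], of "real (Suc m)"]]
  have "((\<lambda>x::real. real (Suc d) * (x ^ d * (1 - x) ^ Suc m)) has_integral
      (real (Suc m) * (fact (Suc d) * fact m / fact (Suc d + m + 1)))) {0..1}"
    by simp
  from has_integral_mult_right[OF this, of "1 / real (Suc d)"]
  have "((\<lambda>x::real. x ^ d * (1 - x) ^ Suc m) has_integral
      (1 / real (Suc d) * (real (Suc m) * (fact (Suc d) * fact m / fact (Suc d + m + 1))))) {0..1}"
    by (simp del: of_nat_Suc power_Suc)
  moreover have "1 / real (Suc d) * (real (Suc m) * (fact (Suc d) * fact m / fact (Suc d + m + 1)))
      = fact d * fact (Suc m) / fact (d + Suc m + 1)"
    by (simp del: of_nat_Suc add: fact_Suc)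
  ultimately show ?case by metis
qed

lemma nn_integral_Beta_weight:
  assumes "k > 0"
  shows "(\<integral>\<^sup>+r. ennreal (real k * (1 - r) ^ (k - 1)) * indicator {0..1} r * ennreal (r ^ d) \<partial>lborel)
           = ennreal (1 / real ((d + k) choose k))"
proof -
  obtain m where m: "k = Suc m" using assms gr0_implies_Suc by blast
  have "(\<integral>\<^sup>+r. ennreal (real k * (1 - r) ^ (k - 1)) * indicator {0..1} r * ennreal (r ^ d) \<partial>lborel)
      = (\<integral>\<^sup>+r. ennreal (real k * (r ^ d * (1 - r) ^ m)) * indicator {0..1} r \<partial>lborel)"
    by (intro nn_integral_cong) (auto simp: m indicator_def ac_simps simp flip: ennreal_mult)
  also have "\<dots> = ennreal (real k * (fact d * fact m / fact (d + m + 1)))"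
    by (intro nn_integral_has_integral_lebesgue' has_integral_mult_right has_integral_Beta_nat) auto
  also have "real k * (fact d * fact m / fact (d + m + 1)) = 1 / real ((d + k) choose k)"
    unfolding binomial_fact[of k "d + k", OF le_add2] by (simp add: m)
  finally show ?thesis .
qed

lemma nn_integral_weight_tail:
  assumes "k > 0" "s \<le> 1"
  shows "(\<integral>\<^sup>+r. ennreal (real k * (1 - r) ^ (k - 1)) * indicator {s..1} r \<partial>lborel) = ennreal ((1 - s) ^ k)"
proof -
  have "((\<lambda>r. real k * (1 - r) ^ (k - 1)) has_integral (- ((1 - 1) ^ k) - - ((1 - s) ^ k))) {s..1}"
    using assms(2)
    by (intro fundamental_theorem_of_calculus)
       (auto intro!: derivative_eq_intros simp flip: has_real_derivative_iff_has_vector_derivative)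
  then show ?thesis
    using assms by (subst nn_integral_has_integral_lebesgue') (auto simp: zero_power)
qed

text \<open>
  Bounds with a coefficient \<open>c\<close> pass to the limit of \<open>c\<close> even when \<open>A\<close> is infinite: multiplication by
  infinity is discontinuous only at a zero coefficient, and there the claim is trivial.
\<close>
lemma ennreal_mult_le_of_tendsto:
  assumes "(c \<longlongrightarrow> l) F" "F \<noteq> bot" "eventually (\<lambda>x. ennreal (c x) * A \<le> X) F"
  shows "ennreal l * A \<le> X"
proof (cases "l > 0")
  case True
  have "((\<lambda>x. ennreal (c x) * A) \<longlongrightarrow> ennreal l * A) F"
    using assms(1) True by (intro tendsto_mult_ennreal tendsto_ennrealI tendsto_const) auto
  then show ?thesis
    using tendsto_upperbound assms(2,3) by blast
qed (simp add: ennreal_neg)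

section \<open>The inequality for convex sets\<close>

lemma convex_section:
  assumes "subspace V" "convex K"
  shows "convex {y\<in>V. x + y \<in> K}"
proof -
  have "{y\<in>V. x + y \<in> K} = V \<inter> (+) (- x) ` K"
    by (force simp: image_iff)
  then show ?thesis
    using assms by (metis convex_Int convex_translation subspace_imp_convex)
qed

lemma sets_convex_section:
  fixes K :: "'a::euclidean_space set"
  assumes "subspace V" "convex K"
  shows "{y\<in>V. x + y \<in> K} \<in> sets (subspace_lebesgue V)"
  by (intro convex_imp_sets_subspace_lebesgue convex_section assms) auto

text \<open>
  The section over \<open>r p\<close> contains \<open>r z + (1 - r) W\<close>, where \<open>W\<close> is the section over \<open>0\<close> and \<open>p + z\<close> is
  a single point of \<open>K\<close>.
\<close>
lemma emeasure_convex_section_ge: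
  fixes K :: "'a::euclidean_space set"
  assumes V: "subspace V" and K: "convex K" and z: "z \<in> V" "p + z \<in> K" and r: "0 \<le> r" "r < 1"
  shows "ennreal ((1 - r) ^ dim V) * emeasure (subspace_lebesgue V) {w\<in>V. w \<in> K}
           \<le> emeasure (subspace_lebesgue V) {y\<in>V. r *\<^sub>R p + y \<in> K}"
proof -
  let ?N = "subspace_lebesgue V"
  let ?S = "{y\<in>V. r *\<^sub>R p + y \<in> K}"
  have S: "?S \<in> sets ?N"
    by (rule sets_convex_section[OF V K])
  have W: "{w\<in>V. w \<in> K} \<in> sets ?N"
    using sets_convex_section[OF V K, of 0] by simp
  have "emeasure ?N {w\<in>V. w \<in> K} = (\<integral>\<^sup>+w. indicator {w\<in>V. w \<in> K} w \<partial>?N)"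
    using W by simp
  also have "\<dots> \<le> (\<integral>\<^sup>+w. indicator ?S (r *\<^sub>R z + (1 - r) *\<^sub>R w) \<partial>?N)"
  proof (rule nn_integral_mono)
    fix w assume "w \<in> space ?N"
    then have w: "w \<in> V" by simp
    have "r *\<^sub>R z + (1 - r) *\<^sub>R w \<in> ?S" if "w \<in> K"
    proof -
      have "r *\<^sub>R (p + z) + (1 - r) *\<^sub>R w \<in> K"
        using K z(2) that r unfolding convex_def by auto
      then show ?thesis
        using V z(1) w by (simp add: algebra_simps subspace_add subspace_scale subspace_diff)
    qed
    then show "indicator {w\<in>V. w \<in> K} w \<le> (indicator ?S (r *\<^sub>R z + (1 - r) *\<^sub>R w) :: ennreal)"
      using w by (auto simp: indicator_def)
  qed
  finally have "ennreal ((1 - r) ^ dim V) * emeasure ?N {w\<in>V. w \<in> K}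
      \<le> ennreal ((1 - r) ^ dim V) * (\<integral>\<^sup>+w. indicator ?S (r *\<^sub>R z + (1 - r) *\<^sub>R w) \<partial>?N)"
    by (rule mult_left_mono) simp
  also have "\<dots> = (\<integral>\<^sup>+y. indicator ?S y \<partial>?N)"
    using nn_integral_subspace_lebesgue_affine[OF V borel_measurable_indicator[OF S], of "r *\<^sub>R z" "1 - r"]
      V z(1) r by (simp add: subspace_scale)
  also have "\<dots> = emeasure ?N ?S"
    using S by simp
  finally show ?thesis .
qed

lemma mem_orth_proj_image_iff:
  assumes "subspace H"
  shows "x \<in> orth_proj H ` K \<longleftrightarrow> x \<in> H \<and> (\<exists>y\<in>H\<^sup>\<bottom>. x + y \<in> K)"
proof
  assume "x \<in> orth_proj H ` K"
  then obtain q where "q \<in> K" "x = orth_proj H q" by blast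
  then show "x \<in> H \<and> (\<exists>y\<in>H\<^sup>\<bottom>. x + y \<in> K)"
    using orth_proj_in[OF assms, of q] orth_proj_residual[OF assms, of q] by (auto intro!: bexI[of _ "q - x"])
next
  assume "x \<in> H \<and> (\<exists>y\<in>H\<^sup>\<bottom>. x + y \<in> K)"
  then show "x \<in> orth_proj H ` K"
    using orth_proj_add[OF assms] by (metis imageI)
qed

text \<open>
  The bound on the section over \<open>x\<close> holds for every \<open>q\<close> with \<open>x \<in> q P(K)\<close>; averaging over such \<open>q\<close> with
  the weight \<open>w\<close> replaces the volume of a section by volumes of dilates of \<open>P(K)\<close>.
  The set \<open>E\<close> collects the pairs \<open>(x, r)\<close> such that \<open>x \<in> q P(K)\<close> for some rational \<open>q < r\<close>.  Using
  rational \<open>q\<close> makes \<open>E\<close> a countable union of rectangles, hence measurable for the product measure;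
  the price is a limit \<open>q \<rightarrow> r\<close> from below in the lower bound for the mass of a slice, and a limit
  towards the least admissible \<open>q\<close> in the upper bound for the average.
\<close>
lemma projection_section_inequality:
  fixes K :: "'a::euclidean_space set" and G :: "'a \<Rightarrow> ennreal"
  assumes H: "subspace H" and K: "convex K" and codim: "dim (H\<^sup>\<bottom>) > 0"
    and G: "G \<in> borel_measurable (subspace_lebesgue H)"
    and radial: "\<And>x t. x \<in> H \<Longrightarrow> 0 \<le> t \<Longrightarrow> t \<le> 1 \<Longrightarrow> G x \<le> G (t *\<^sub>R x)"
  shows "emeasure (subspace_lebesgue (H\<^sup>\<bottom>)) {y\<in>H\<^sup>\<bottom>. y \<in> K}
           * (\<integral>\<^sup>+x. G x * indicator (orth_proj H ` K) x \<partial>subspace_lebesgue H)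
         \<le> ennreal (real ((dim H + dim (H\<^sup>\<bottom>)) choose dim (H\<^sup>\<bottom>)))
           * (\<integral>\<^sup>+x. G x * emeasure (subspace_lebesgue (H\<^sup>\<bottom>)) {y\<in>H\<^sup>\<bottom>. x + y \<in> K} \<partial>subspace_lebesgue H)"
proof -
  let ?N = "subspace_lebesgue H"
  let ?k = "dim (H\<^sup>\<bottom>)" and ?d = "dim H" and ?L = "orth_proj H ` K"
  let ?\<phi> = "\<lambda>x. emeasure (subspace_lebesgue (H\<^sup>\<bottom>)) {y\<in>H\<^sup>\<bottom>. x + y \<in> K}"
  let ?V = "emeasure (subspace_lebesgue (H\<^sup>\<bottom>)) {y\<in>H\<^sup>\<bottom>. y \<in> K}"
  let ?A = "\<integral>\<^sup>+x. G x * indicator ?L x \<partial>?N"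
  let ?C = "real ((?d + ?k) choose ?k)"
  define Q where "Q = \<rat> \<inter> {0<..<1::real}"
  define sL where "sL = (\<lambda>q. {x\<in>H. (1 / q) *\<^sub>R x \<in> ?L})"
  define E where "E = (\<Union>q\<in>Q. sL q \<times> {q<..})"
  define w where "w = (\<lambda>r. ennreal (real ?k * (1 - r) ^ (?k - 1)) * indicator {0..1} r)"
  have Lconv: "convex ?L"
    by (rule convex_linear_image[OF linear_orth_proj[OF H] K])
  have sL_sets: "sL q \<in> sets ?N" for q
  proof (rule convex_imp_sets_subspace_lebesgue[OF H])
    have "sL q = H \<inter> (\<lambda>x. (1 / q) *\<^sub>R x) -` ?L"
      by (auto simp: sL_def)
    then show "convex (sL q)"
      using Lconv H by (metis convex_Int convex_linear_vimage linear_scale_self subspace_imp_convex)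
  qed (auto simp: sL_def)
  have w_meas: "w \<in> borel_measurable lborel"
    unfolding w_def by simp
  have E_sets: "E \<in> sets (?N \<Otimes>\<^sub>M lborel)"
    unfolding E_def
  proof (rule sets.countable_UN'')
    show "countable Q"
      unfolding Q_def by (intro countable_Int1 countable_rat)
    show "sL q \<times> {q<..} \<in> sets (?N \<Otimes>\<^sub>M lborel)" for q
      by (intro pair_measureI sL_sets) simp
  qed
  have scaled_sections: "ennreal ((1 - q) ^ ?k) * ?V \<le> ?\<phi> x" if qQ: "q \<in> Q" and xq: "x \<in> sL q" for q x
  proof -
    have q: "0 < q" "q < 1" using qQ by (auto simp: Q_def)
    obtain z where "z \<in> H\<^sup>\<bottom>" "(1 / q) *\<^sub>R x + z \<in> K"
      using xq mem_orth_proj_image_iff[OF H] unfolding sL_def by blast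
    from emeasure_convex_section_ge[OF subspace_orthogonal_comp K this, of q] show ?thesis
      using q by simp
  qed
  have average_sections: "(\<integral>\<^sup>+r. w r * indicator E (x, r) \<partial>lborel) * ?V \<le> ?\<phi> x" if x: "x \<in> H" for x
  proof (cases "\<exists>q\<in>Q. x \<in> sL q")
    case False
    then have "indicator E (x, r) = (0::ennreal)" for r
      by (auto simp: E_def)
    then show ?thesis by simp
  next
    case True
    define R where "R = {q\<in>Q. x \<in> sL q}"
    define s where "s = Inf R"
    have R: "R \<noteq> {}" "bdd_below R"
      using True by (auto simp: R_def Q_def intro!: bdd_belowI[of _ 0])
    then obtain q where q: "q \<in> R" by blast
    have s: "0 \<le> s" "s < 1"
      using R q cInf_lower[OF q R(2)] cInf_greatest[OF R(1), of 0]
      by (force simp: s_def R_def Q_def)+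
    \<comment> \<open>The part of the fibre of \<open>E\<close> over \<open>x\<close> where \<open>w\<close> lives is in \<open>[s, 1]\<close>, which has weight \<open>(1 - s)\<^sup>k\<close>.\<close>
    have "(\<integral>\<^sup>+r. w r * indicator E (x, r) \<partial>lborel)
        \<le> (\<integral>\<^sup>+r. ennreal (real ?k * (1 - r) ^ (?k - 1)) * indicator {s..1} r \<partial>lborel)"
    proof (rule nn_integral_mono)
      fix r :: real
      have "s \<le> r" if "(x, r) \<in> E"
      proof -
        obtain q where "q \<in> R" "q < r"
          using \<open>(x, r) \<in> E\<close> by (auto simp: E_def R_def)
        then show ?thesis
          using cInf_lower[OF _ R(2), of q] by (simp add: s_def)
      qed
      then show "w r * indicator E (x, r) \<le> ennreal (real ?k * (1 - r) ^ (?k - 1)) * indicator {s..1} r"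
        by (auto simp: w_def indicator_def)
    qed
    also have "\<dots> = ennreal ((1 - s) ^ ?k)"
      using codim s by (intro nn_integral_weight_tail) auto
    finally have "(\<integral>\<^sup>+r. w r * indicator E (x, r) \<partial>lborel) * ?V \<le> ennreal ((1 - s) ^ ?k) * ?V"
      by (rule mult_right_mono) simp
    also have "\<dots> \<le> ?\<phi> x"
    proof (rule ennreal_mult_le_of_tendsto[where F = "at_right s" and c = "\<lambda>t. (1 - t) ^ ?k"])
      show "\<forall>\<^sub>F t in at_right s. ennreal ((1 - t) ^ ?k) * ?V \<le> ?\<phi> x"
        using eventually_at_right_real[OF s(2)]
      proof (rule eventually_mono)
        fix t assume t: "t \<in> {s<..<1}"
        then obtain q where q: "q \<in> R" "q < t"
          using cInf_lessD[OF R(1), of t] by (auto simp: s_def)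
        have "ennreal ((1 - t) ^ ?k) * ?V \<le> ennreal ((1 - q) ^ ?k) * ?V"
          using q t by (intro mult_right_mono ennreal_leI power_mono) auto
        also have "\<dots> \<le> ?\<phi> x"
          using q by (intro scaled_sections) (auto simp: R_def)
        finally show "ennreal ((1 - t) ^ ?k) * ?V \<le> ?\<phi> x" .
      qed
    qed (auto intro!: tendsto_eq_intros)
    finally show ?thesis .
  qed
  \<comment> \<open>The substitution \<open>x \<mapsto> q x\<close> maps \<open>P(K)\<close> onto \<open>q P(K)\<close> and can only increase \<open>G\<close>.\<close>
  have scaled_weight: "ennreal (r ^ ?d) * ?A \<le> (\<integral>\<^sup>+x. G x * indicator E (x, r) \<partial>?N)" if r: "0 < r" "r \<le> 1" for r
  proof (rule ennreal_mult_le_of_tendsto[where F = "at_left r" and c = "\<lambda>t. t ^ ?d"])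
    show "\<forall>\<^sub>F t in at_left r. ennreal (t ^ ?d) * ?A \<le> (\<integral>\<^sup>+x. G x * indicator E (x, r) \<partial>?N)"
      using eventually_at_left_real[OF r(1)]
    proof (rule eventually_mono)
      fix t assume t: "t \<in> {0<..<r}"
      then obtain q where q: "q \<in> \<rat>" "t < q" "q < r"
        using Rats_dense_in_real[of t r] by auto
      with r t have qQ: "q \<in> Q" by (auto simp: Q_def)
      have "ennreal (t ^ ?d) * ?A \<le> ennreal (q ^ ?d) * ?A"
        using q t by (intro mult_right_mono ennreal_leI power_mono) auto
      also have "\<dots> \<le> ennreal (q ^ ?d) * (\<integral>\<^sup>+x. G (0 + q *\<^sub>R x) * indicator (sL q) (0 + q *\<^sub>R x) \<partial>?N)"
      proof (intro mult_left_mono nn_integral_mono)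
        fix x assume "x \<in> space ?N"
        then show "G x * indicator ?L x \<le> G (0 + q *\<^sub>R x) * indicator (sL q) (0 + q *\<^sub>R x)"
          using q t r radial[of x q] H by (auto simp: indicator_def sL_def subspace_scale)
      qed simp
      also have "\<dots> = (\<integral>\<^sup>+x. G x * indicator (sL q) x \<partial>?N)"
        using nn_integral_subspace_lebesgue_affine[OF H, of "\<lambda>x. G x * indicator (sL q) x" 0 q] G sL_sets q t
        by (simp add: subspace_0[OF H])
      also have "\<dots> \<le> (\<integral>\<^sup>+x. G x * indicator E (x, r) \<partial>?N)"
        using qQ q by (intro nn_integral_mono mult_left_mono) (auto simp: indicator_def E_def)
      finally show "ennreal (t ^ ?d) * ?A \<le> (\<integral>\<^sup>+x. G x * indicator E (x, r) \<partial>?N)" .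
    qed
  qed (auto intro!: tendsto_eq_intros)
  interpret pair_sigma_finite ?N "lborel :: real measure"
    by (intro pair_sigma_finite.intro sigma_finite_subspace_lebesgue H lborel.sigma_finite_measure_axioms)
  have E_meas: "(\<lambda>p. indicator E p :: ennreal) \<in> borel_measurable (?N \<Otimes>\<^sub>M lborel)"
    by (rule borel_measurable_indicator[OF E_sets])
  have E1: "(\<lambda>r. indicator E (x, r) :: ennreal) \<in> borel_measurable lborel" if "x \<in> H" for x
    using measurable_Pair2[OF E_meas, of x] that by simp
  have E2: "(\<lambda>x. indicator E (x, r) :: ennreal) \<in> borel_measurable ?N" for r
    using measurable_Pair1[OF E_meas, of r] by simp
  have w_pow: "(\<lambda>r. w r * ennreal (r ^ ?d)) \<in> borel_measurable lborel"
    unfolding w_def by simp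
  have "ennreal (1 / ?C) * (?V * ?A) = (\<integral>\<^sup>+r. w r * ennreal (r ^ ?d) \<partial>lborel) * (?V * ?A)"
    unfolding w_def using nn_integral_Beta_weight[OF codim, of ?d] by simp
  also have "\<dots> = (\<integral>\<^sup>+r. w r * ennreal (r ^ ?d) * (?V * ?A) \<partial>lborel)"
    by (rule nn_integral_multc[OF w_pow, symmetric])
  also have "\<dots> \<le> (\<integral>\<^sup>+r. (\<integral>\<^sup>+x. G x * (w r * indicator E (x, r) * ?V) \<partial>?N) \<partial>lborel)"
  \<comment> \<open>At \<open>r = 0\<close> the slice of \<open>E\<close> is empty, but \<open>r\<^sup>d = 1\<close> if \<open>d = 0\<close>.\<close>
  proof (rule nn_integral_mono_AE)
    show "AE r in lborel. w r * ennreal (r ^ ?d) * (?V * ?A) \<le> (\<integral>\<^sup>+x. G x * (w r * indicator E (x, r) * ?V) \<partial>?N)"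
      using AE_lborel_singleton[of "0::real"]
    proof (rule AE_mp, rule_tac AE_I2, rule_tac impI)
      fix r :: real assume "r \<noteq> 0"
      show "w r * ennreal (r ^ ?d) * (?V * ?A) \<le> (\<integral>\<^sup>+x. G x * (w r * indicator E (x, r) * ?V) \<partial>?N)"
      proof (cases "0 \<le> r \<and> r \<le> 1")
        case True
        with \<open>r \<noteq> 0\<close> have "w r * ?V * (ennreal (r ^ ?d) * ?A) \<le> w r * ?V * (\<integral>\<^sup>+x. G x * indicator E (x, r) \<partial>?N)"
          by (intro mult_left_mono scaled_weight) auto
        also have "\<dots> = (\<integral>\<^sup>+x. w r * ?V * (G x * indicator E (x, r)) \<partial>?N)"
          using G E2[of r] by (intro nn_integral_cmult[symmetric]) simp
        finally show ?thesis by (simp add: ac_simps)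
      qed (auto simp: w_def)
    qed
  qed
  also have "\<dots> = (\<integral>\<^sup>+x. (\<integral>\<^sup>+r. G x * (w r * indicator E (x, r) * ?V) \<partial>lborel) \<partial>?N)"
  proof (rule Fubini')
    have "(\<lambda>p. G (fst p)) \<in> borel_measurable (?N \<Otimes>\<^sub>M lborel)"
      by (rule measurable_compose[OF measurable_fst G])
    moreover have "(\<lambda>p. w (snd p)) \<in> borel_measurable (?N \<Otimes>\<^sub>M lborel)"
      by (rule measurable_compose[OF measurable_snd w_meas])
    ultimately show "(\<lambda>(x, r). G x * (w r * indicator E (x, r) * ?V)) \<in> borel_measurable (?N \<Otimes>\<^sub>M lborel)"
      unfolding case_prod_unfold prod.collapse using E_meas
      by (intro borel_measurable_times_ennreal borel_measurable_const)
  qed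
  also have "\<dots> \<le> (\<integral>\<^sup>+x. G x * ?\<phi> x \<partial>?N)"
  proof (rule nn_integral_mono)
    fix x assume "x \<in> space ?N"
    then have x: "x \<in> H" by simp
    have "(\<integral>\<^sup>+r. G x * (w r * indicator E (x, r) * ?V) \<partial>lborel)
        = G x * ((\<integral>\<^sup>+r. w r * indicator E (x, r) \<partial>lborel) * ?V)"
      using w_meas E1[OF x] by (simp add: nn_integral_cmult nn_integral_multc)
    also have "\<dots> \<le> G x * ?\<phi> x"
      by (intro mult_left_mono average_sections x) simp
    finally show "(\<integral>\<^sup>+r. G x * (w r * indicator E (x, r) * ?V) \<partial>lborel) \<le> G x * ?\<phi> x" .
  qed
  finally have "ennreal ?C * (ennreal (1 / ?C) * (?V * ?A)) \<le> ennreal ?C * (\<integral>\<^sup>+x. G x * ?\<phi> x \<partial>?N)"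
    by (rule mult_left_mono) simp
  moreover have "ennreal ?C * (ennreal (1 / ?C) * (?V * ?A)) = ?V * ?A"
  proof -
    have "?C > 0" by (simp add: zero_less_binomial)
    then have "ennreal ?C * ennreal (1 / ?C) = 1"
      by (subst ennreal_mult[symmetric]) auto
    then show ?thesis by (simp add: mult.assoc[symmetric])
  qed
  ultimately show ?thesis by simp
qed

section \<open>From convex sets to quasi-concave functions\<close>

lemma nn_integral_orth_proj_indicator:
  fixes K :: "'a::euclidean_space set" and G :: "'a \<Rightarrow> ennreal"
  assumes H: "subspace H" and K: "convex K" and G: "G \<in> borel_measurable (subspace_lebesgue H)"
  shows "(\<integral>\<^sup>+x. G (orth_proj H x) * indicator K x \<partial>lebesgue)
           = (\<integral>\<^sup>+x. G x * emeasure (subspace_lebesgue (H\<^sup>\<bottom>)) {y\<in>H\<^sup>\<bottom>. x + y \<in> K} \<partial>subspace_lebesgue H)"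
proof -
  have "(\<lambda>x. G (orth_proj H x) * indicator K x) \<in> borel_measurable lebesgue"
    by (intro borel_measurable_times_ennreal measurable_compose[OF measurable_orth_proj_lebesgue[OF H] G]
          borel_measurable_indicator convex_imp_sets_lebesgue K)
  from nn_integral_lebesgue_orthogonal_sum[OF H this]
  have "(\<integral>\<^sup>+x. G (orth_proj H x) * indicator K x \<partial>lebesgue)
      = (\<integral>\<^sup>+x. (\<integral>\<^sup>+y. G (orth_proj H (x + y)) * indicator K (x + y) \<partial>subspace_lebesgue (H\<^sup>\<bottom>)) \<partial>subspace_lebesgue H)" .
  also have "\<dots> = (\<integral>\<^sup>+x. G x * emeasure (subspace_lebesgue (H\<^sup>\<bottom>)) {y\<in>H\<^sup>\<bottom>. x + y \<in> K} \<partial>subspace_lebesgue H)"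
  proof (rule nn_integral_cong)
    fix x assume "x \<in> space (subspace_lebesgue H)"
    then have x: "x \<in> H" by simp
    have S: "{y\<in>H\<^sup>\<bottom>. x + y \<in> K} \<in> sets (subspace_lebesgue (H\<^sup>\<bottom>))"
      by (rule sets_convex_section[OF subspace_orthogonal_comp K])
    have "(\<integral>\<^sup>+y. G (orth_proj H (x + y)) * indicator K (x + y) \<partial>subspace_lebesgue (H\<^sup>\<bottom>))
        = (\<integral>\<^sup>+y. G x * indicator {y\<in>H\<^sup>\<bottom>. x + y \<in> K} y \<partial>subspace_lebesgue (H\<^sup>\<bottom>))"
      by (intro nn_integral_cong) (simp add: orth_proj_add[OF H x] indicator_def)
    also have "\<dots> = G x * emeasure (subspace_lebesgue (H\<^sup>\<bottom>)) {y\<in>H\<^sup>\<bottom>. x + y \<in> K}"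
      by (rule nn_integral_cmult_indicator[OF S])
    finally show "(\<integral>\<^sup>+y. G (orth_proj H (x + y)) * indicator K (x + y) \<partial>subspace_lebesgue (H\<^sup>\<bottom>)) = \<dots>" .
  qed
  finally show ?thesis .
qed

lemma quasi_concave_imp_convex_superlevel:
  assumes "quasi_concave f"
  shows "convex {x. t < f x}"
  unfolding convex_alt
proof (intro ballI allI impI)
  fix x y u assume xy: "x \<in> {x. t < f x}" "y \<in> {x. t < f x}" and u: "0 \<le> u \<and> u \<le> (1::real)"
  show "(1 - u) *\<^sub>R x + u *\<^sub>R y \<in> {x. t < f x}"
  proof (cases "u = 0 \<or> u = 1")
    case False
    with u have "min (f x) (f y) \<le> f ((1 - u) *\<^sub>R x + u *\<^sub>R y)"
      using assms by (auto simp: quasi_concave_def)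
    then show ?thesis using xy by auto
  qed (use xy in auto)
qed

lemma less_proj_fun_iff:
  assumes "bdd_above (range f)"
  shows "t < proj_fun H f x \<longleftrightarrow> (\<exists>y\<in>H\<^sup>\<bottom>. t < f (x + y))"
  unfolding proj_fun_def
proof (rule less_cSUP_iff)
  show "H\<^sup>\<bottom> \<noteq> {}"
    using subspace_0[OF subspace_orthogonal_comp] by blast
  show "bdd_above ((\<lambda>y. f (x + y)) ` (H\<^sup>\<bottom>))"
    by (rule bdd_above_mono[OF assms]) auto
qed

lemma nn_integral_indicator_atLeastLessThan:
  "0 \<le> a \<Longrightarrow> (\<integral>\<^sup>+t. indicator {0..<a} t \<partial>lborel) = ennreal (a::real)"
  by simp

text \<open>
  Only the levels \<open>t \<ge> 0\<close> contribute to the layer-cake formula, which is why \<open>V t\<close> is written with the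
  indicator of \<open>{0..<f y}\<close>: it equals the volume of the central section of the superlevel set for
  \<open>t \<ge> 0\<close> and vanishes for \<open>t < 0\<close>.
\<close>
lemma quasi_concave_projection_section_inequality:
  fixes f :: "'a::euclidean_space \<Rightarrow> real" and G :: "'a \<Rightarrow> ennreal"
  assumes H: "subspace H" and codim: "dim (H\<^sup>\<bottom>) > 0"
    and f: "\<And>x. 0 \<le> f x" "\<And>x. f x \<le> M" "quasi_concave f"
    and G: "G \<in> borel_measurable (subspace_lebesgue H)"
    and radial: "\<And>x t. x \<in> H \<Longrightarrow> 0 \<le> t \<Longrightarrow> t \<le> 1 \<Longrightarrow> G x \<le> G (t *\<^sub>R x)"
  shows "(\<integral>\<^sup>+x. G x * ennreal (proj_fun H f x) \<partial>subspace_lebesgue H)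
           * (\<integral>\<^sup>+y. ennreal (f y) \<partial>subspace_lebesgue (H\<^sup>\<bottom>))
         \<le> ennreal (real ((dim H + dim (H\<^sup>\<bottom>)) choose dim (H\<^sup>\<bottom>)) * M)
           * (\<integral>\<^sup>+x. G (orth_proj H x) * ennreal (f x) \<partial>lebesgue)"
proof -
  let ?N = "subspace_lebesgue H" and ?N' = "subspace_lebesgue (H\<^sup>\<bottom>)"
  let ?C = "real ((dim H + dim (H\<^sup>\<bottom>)) choose dim (H\<^sup>\<bottom>))"
  let ?P = "orth_proj H" and ?Pf = "proj_fun H f"
  let ?K = "\<lambda>t. {x. t < f x}"
  define V where "V = (\<lambda>t. \<integral>\<^sup>+y. indicator {0..<f y} t \<partial>?N')"
  note H' = subspace_orthogonal_comp[of H]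
  have M: "0 \<le> M" using f(1,2) order_trans by blast
  have bdd: "bdd_above (range f)" using f(2) by (auto intro!: bdd_aboveI)
  have K: "convex (?K t)" for t
    by (rule quasi_concave_imp_convex_superlevel[OF f(3)])
  have Pf_iff: "t < ?Pf x \<longleftrightarrow> x \<in> ?P ` ?K t" if "x \<in> H" for t x
    using that by (simp add: less_proj_fun_iff[OF bdd] mem_orth_proj_image_iff[OF H])
  have Pf_nn: "0 \<le> ?Pf x" for x
  proof (rule ccontr)
    assume "\<not> 0 \<le> ?Pf x"
    then have "?Pf x < f (x + 0)"
      using f(1)[of "x + 0"] by linarith
    then show False
      using less_proj_fun_iff[OF bdd, of "?Pf x" H x] subspace_0[OF H'] by blast
  qed
  have Pf_le: "?Pf x \<le> M" for x
    using less_proj_fun_iff[OF bdd, of M H x] f(2) by (auto simp: not_less[symmetric])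
  have f_leb [measurable]: "f \<in> borel_measurable lebesgue"
    using convex_imp_sets_lebesgue[OF K] by (simp add: borel_measurable_iff_greater)
  have f_N' [measurable]: "f \<in> borel_measurable ?N'"
    using sets_convex_section[OF H' K, of 0] by (simp add: borel_measurable_iff_greater)
  have PK_sets: "?P ` ?K t \<in> sets ?N" for t
    using orth_proj_in[OF H]
    by (intro convex_imp_sets_subspace_lebesgue H convex_linear_image linear_orth_proj K) auto
  have Pf_N [measurable]: "?Pf \<in> borel_measurable ?N"
  proof -
    have "{x\<in>H. t < ?Pf x} = ?P ` ?K t" for t
      using Pf_iff orth_proj_in[OF H] by blast
    then show ?thesis
      using PK_sets by (simp add: borel_measurable_iff_greater)
  qed
  interpret leb: pair_sigma_finite "lebesgue :: 'a measure" "lborel :: real measure"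
    by (intro pair_sigma_finite.intro sigma_finite_measure_completion lborel.sigma_finite_measure_axioms)
  interpret N: pair_sigma_finite ?N "lborel :: real measure"
    by (intro pair_sigma_finite.intro sigma_finite_subspace_lebesgue H lborel.sigma_finite_measure_axioms)
  interpret N': pair_sigma_finite ?N' "lborel :: real measure"
    by (intro pair_sigma_finite.intro sigma_finite_subspace_lebesgue H' lborel.sigma_finite_measure_axioms)
  have below_meas: "(\<lambda>p. indicator {0..<h (fst p)} (snd p) :: ennreal) \<in> borel_measurable (X \<Otimes>\<^sub>M (lborel :: real measure))"
    if [measurable]: "h \<in> borel_measurable X" for X :: "'a measure" and h :: "'a \<Rightarrow> real"
  proof -
    let ?D = "{p \<in> space (X \<Otimes>\<^sub>M (lborel :: real measure)). 0 \<le> snd p \<and> snd p < h (fst p)}"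
    have "?D \<in> sets (X \<Otimes>\<^sub>M (lborel :: real measure))"
      by measurable
    then have "(\<lambda>p. indicator ?D p :: ennreal) \<in> borel_measurable (X \<Otimes>\<^sub>M lborel)"
      by (rule borel_measurable_indicator)
    then show ?thesis
      by (rule measurable_cong[THEN iffD1, rotated]) (auto simp: indicator_def)
  qed
  have V_meas [measurable]: "V \<in> borel_measurable lborel"
    unfolding V_def
    using measurable_pair_swap[OF below_meas[OF f_N']]
    by (intro N'.M1.borel_measurable_nn_integral) (simp add: case_prod_unfold)
  have V_emeasure: "V t = emeasure ?N' {y\<in>H\<^sup>\<bottom>. y \<in> ?K t}" if "0 \<le> t" for t
  proof -
    have "V t = (\<integral>\<^sup>+y. indicator {y\<in>H\<^sup>\<bottom>. y \<in> ?K t} y \<partial>?N')"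
      unfolding V_def using that by (intro nn_integral_cong) (simp add: indicator_def)
    then show ?thesis
      using sets_convex_section[OF H' K, of 0] by simp
  qed
  have V_integral: "(\<integral>\<^sup>+t. indicator {0..<b} t * V t \<partial>lborel) = (\<integral>\<^sup>+y. ennreal (min b (f y)) \<partial>?N')"
    if "0 \<le> b" for b
  proof -
    have "(\<lambda>y. indicator {0..<f y} t :: ennreal) \<in> borel_measurable ?N'" for t
      using measurable_Pair1[OF below_meas[OF f_N'], of t] by simp
    then have "(\<integral>\<^sup>+t. indicator {0..<b} t * V t \<partial>lborel)
        = (\<integral>\<^sup>+t. (\<integral>\<^sup>+y. indicator {0..<b} t * indicator {0..<f y} t \<partial>?N') \<partial>lborel)"
      unfolding V_def by (simp add: nn_integral_cmult)
    also have "\<dots> = (\<integral>\<^sup>+y. (\<integral>\<^sup>+t. indicator {0..<b} t * indicator {0..<f y} t \<partial>lborel) \<partial>?N')"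
    proof (rule N'.Fubini')
      show "(\<lambda>(y, t). indicator {0..<b} t * indicator {0..<f y} t :: ennreal) \<in> borel_measurable (?N' \<Otimes>\<^sub>M lborel)"
        unfolding case_prod_unfold by (intro borel_measurable_times_ennreal below_meas borel_measurable_const f_N')
    qed
    also have "\<dots> = (\<integral>\<^sup>+y. (\<integral>\<^sup>+t. indicator {0..<min b (f y)} t \<partial>lborel) \<partial>?N')"
      by (intro nn_integral_cong) (simp add: indicator_def)
    also have "\<dots> = (\<integral>\<^sup>+y. ennreal (min b (f y)) \<partial>?N')"
      using that f(1) by (intro nn_integral_cong nn_integral_indicator_atLeastLessThan) simp
    finally show ?thesis .
  qed
  have joint_H: "(\<lambda>(x, t). G x * (indicator {0..<?Pf x} t * V t)) \<in> borel_measurable (?N \<Otimes>\<^sub>M lborel)"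
    unfolding case_prod_unfold
    by (intro borel_measurable_times_ennreal below_meas Pf_N
          measurable_compose[OF measurable_fst G] measurable_compose[OF measurable_snd V_meas])
  have joint_leb: "(\<lambda>(x, t). G (?P x) * indicator {0..<f x} t) \<in> borel_measurable (lebesgue \<Otimes>\<^sub>M lborel)"
    unfolding case_prod_unfold
    by (intro borel_measurable_times_ennreal below_meas f_leb
          measurable_compose[OF measurable_fst measurable_compose[OF measurable_orth_proj_lebesgue[OF H] G]])
  have level: "V t * (\<integral>\<^sup>+x. G x * indicator (?P ` ?K t) x \<partial>?N)
      \<le> ennreal ?C * (\<integral>\<^sup>+x. G (?P x) * indicator (?K t) x \<partial>lebesgue)" if "0 \<le> t" for t
    unfolding V_emeasure[OF that] nn_integral_orth_proj_indicator[OF H K G]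
    by (rule projection_section_inequality[OF H K codim G radial])
  have "(\<integral>\<^sup>+x. G x * ennreal (?Pf x) \<partial>?N) * (\<integral>\<^sup>+y. ennreal (f y) \<partial>?N')
      = (\<integral>\<^sup>+x. G x * (\<integral>\<^sup>+y. ennreal (?Pf x * f y) \<partial>?N') \<partial>?N)"
  proof -
    have "(\<integral>\<^sup>+y. ennreal (?Pf x * f y) \<partial>?N') = ennreal (?Pf x) * (\<integral>\<^sup>+y. ennreal (f y) \<partial>?N')" for x
      by (simp add: ennreal_mult Pf_nn f(1) nn_integral_cmult)
    then show ?thesis
      using G by (simp add: nn_integral_multc mult.assoc[symmetric])
  qed
  also have "\<dots> \<le> (\<integral>\<^sup>+x. G x * (ennreal M * (\<integral>\<^sup>+t. indicator {0..<?Pf x} t * V t \<partial>lborel)) \<partial>?N)"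
  proof (intro nn_integral_mono mult_left_mono)
    fix x
    have "(\<integral>\<^sup>+y. ennreal (?Pf x * f y) \<partial>?N') \<le> (\<integral>\<^sup>+y. ennreal (M * min (?Pf x) (f y)) \<partial>?N')"
    proof (intro nn_integral_mono ennreal_leI)
      fix y
      \<comment> \<open>The larger of two numbers in \<open>[0, M]\<close> is at most \<open>M\<close>.\<close>
      show "?Pf x * f y \<le> M * min (?Pf x) (f y)"
        using mult_right_mono[OF Pf_le[of x] f(1)[of y]] mult_right_mono[OF f(2)[of y] Pf_nn[of x]]
        by (simp add: min_def mult.commute)
    qed
    also have "\<dots> = ennreal M * (\<integral>\<^sup>+y. ennreal (min (?Pf x) (f y)) \<partial>?N')"
      using M by (simp add: ennreal_mult Pf_nn f(1) nn_integral_cmult)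
    finally show "(\<integral>\<^sup>+y. ennreal (?Pf x * f y) \<partial>?N') \<le> ennreal M * (\<integral>\<^sup>+t. indicator {0..<?Pf x} t * V t \<partial>lborel)"
      by (simp add: V_integral[OF Pf_nn])
  qed simp
  also have "\<dots> = ennreal M * (\<integral>\<^sup>+x. (\<integral>\<^sup>+t. G x * (indicator {0..<?Pf x} t * V t) \<partial>lborel) \<partial>?N)"
  proof -
    have "(\<integral>\<^sup>+t. G x * (indicator {0..<?Pf x} t * V t) \<partial>lborel)
        = G x * (\<integral>\<^sup>+t. indicator {0..<?Pf x} t * V t \<partial>lborel)" for x
      by (rule nn_integral_cmult) simp
    moreover have "(\<lambda>x. \<integral>\<^sup>+t. G x * (indicator {0..<?Pf x} t * V t) \<partial>lborel) \<in> borel_measurable ?N"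
      by (rule lborel.borel_measurable_nn_integral[OF joint_H])
    ultimately show ?thesis
      by (subst nn_integral_cmult[symmetric]) (simp_all add: ac_simps)
  qed
  finally have separated: "(\<integral>\<^sup>+x. G x * ennreal (?Pf x) \<partial>?N) * (\<integral>\<^sup>+y. ennreal (f y) \<partial>?N')
      \<le> ennreal M * (\<integral>\<^sup>+x. (\<integral>\<^sup>+t. G x * (indicator {0..<?Pf x} t * V t) \<partial>lborel) \<partial>?N)" .
  have "(\<integral>\<^sup>+x. (\<integral>\<^sup>+t. G x * (indicator {0..<?Pf x} t * V t) \<partial>lborel) \<partial>?N)
      = (\<integral>\<^sup>+t. (\<integral>\<^sup>+x. G x * (indicator {0..<?Pf x} t * V t) \<partial>?N) \<partial>lborel)"
    by (rule N.Fubini'[OF joint_H, symmetric])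
  also have "\<dots> = (\<integral>\<^sup>+t. indicator {0..} t * (V t * (\<integral>\<^sup>+x. G x * indicator (?P ` ?K t) x \<partial>?N)) \<partial>lborel)"
  proof (rule nn_integral_cong)
    fix t :: real
    have "(\<integral>\<^sup>+x. G x * (indicator {0..<?Pf x} t * V t) \<partial>?N)
        = (\<integral>\<^sup>+x. (indicator {0..} t * V t) * (G x * indicator (?P ` ?K t) x) \<partial>?N)"
      using Pf_iff by (intro nn_integral_cong) (auto simp: indicator_def ac_simps)
    also have "\<dots> = (indicator {0..} t * V t) * (\<integral>\<^sup>+x. G x * indicator (?P ` ?K t) x \<partial>?N)"
      by (intro nn_integral_cmult borel_measurable_times_ennreal G borel_measurable_indicator PK_sets)
    finally show "(\<integral>\<^sup>+x. G x * (indicator {0..<?Pf x} t * V t) \<partial>?N)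
        = indicator {0..} t * (V t * (\<integral>\<^sup>+x. G x * indicator (?P ` ?K t) x \<partial>?N))"
      by (simp add: mult.assoc)
  qed
  also have "\<dots> \<le> (\<integral>\<^sup>+t. ennreal ?C * (\<integral>\<^sup>+x. G (?P x) * indicator {0..<f x} t \<partial>lebesgue) \<partial>lborel)"
  proof (rule nn_integral_mono)
    fix t :: real
    show "indicator {0..} t * (V t * (\<integral>\<^sup>+x. G x * indicator (?P ` ?K t) x \<partial>?N))
        \<le> ennreal ?C * (\<integral>\<^sup>+x. G (?P x) * indicator {0..<f x} t \<partial>lebesgue)"
    proof (cases "0 \<le> t")
      case True
      then have "indicator (?K t) x = (indicator {0..<f x} t :: ennreal)" for x
        by (simp add: indicator_def)
      with level[OF True] True show ?thesis by simp
    qed simp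
  qed
  also have "\<dots> = ennreal ?C * (\<integral>\<^sup>+t. (\<integral>\<^sup>+x. G (?P x) * indicator {0..<f x} t \<partial>lebesgue) \<partial>lborel)"
    using measurable_pair_swap[OF joint_leb]
    by (intro nn_integral_cmult leb.M1.borel_measurable_nn_integral) (simp add: case_prod_unfold)
  also have "(\<integral>\<^sup>+t. (\<integral>\<^sup>+x. G (?P x) * indicator {0..<f x} t \<partial>lebesgue) \<partial>lborel)
      = (\<integral>\<^sup>+x. (\<integral>\<^sup>+t. G (?P x) * indicator {0..<f x} t \<partial>lborel) \<partial>lebesgue)"
    by (rule leb.Fubini'[OF joint_leb])
  also have "\<dots> = (\<integral>\<^sup>+x. G (?P x) * ennreal (f x) \<partial>lebesgue)"
    using f(1) by (intro nn_integral_cong) (simp add: nn_integral_cmult nn_integral_indicator_atLeastLessThan)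
  finally have "(\<integral>\<^sup>+x. (\<integral>\<^sup>+t. G x * (indicator {0..<?Pf x} t * V t) \<partial>lborel) \<partial>?N)
      \<le> ennreal ?C * (\<integral>\<^sup>+x. G (?P x) * ennreal (f x) \<partial>lebesgue)" .
  then have "ennreal M * (\<integral>\<^sup>+x. (\<integral>\<^sup>+t. G x * (indicator {0..<?Pf x} t * V t) \<partial>lborel) \<partial>?N)
      \<le> ennreal M * (ennreal ?C * (\<integral>\<^sup>+x. G (?P x) * ennreal (f x) \<partial>lebesgue))"
    by (rule mult_left_mono) simp
  with separated have "(\<integral>\<^sup>+x. G x * ennreal (?Pf x) \<partial>?N) * (\<integral>\<^sup>+y. ennreal (f y) \<partial>?N')
      \<le> ennreal M * (ennreal ?C * (\<integral>\<^sup>+x. G (?P x) * ennreal (f x) \<partial>lebesgue))"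
    by (rule order_trans)
  also have "\<dots> = ennreal (?C * M) * (\<integral>\<^sup>+x. G (?P x) * ennreal (f x) \<partial>lebesgue)"
    using M by (simp add: ennreal_mult ac_simps)
  finally show ?thesis .
qed

lemma dim_orthogonal_comp:
  fixes H :: "'a::euclidean_space set"
  assumes "subspace H"
  shows "dim H + dim (H\<^sup>\<bottom>) = DIM('a)"
  using dim_subspace_orthogonal_to_vectors[OF assms subspace_UNIV]
  by (simp add: orthogonal_comp_def add.commute)

theorem theorem1p4:
  fixes k :: nat and H :: "(real ^ 'n) set" and f g :: "real ^ 'n \<Rightarrow> real"
  assumes "k \<in> {1..CARD('n) - 1}"
    and "subspace H" and "dim H = CARD('n) - k"
    and "\<And>x. 0 \<le> f x" and "bounded (range f)" and "quasi_concave f"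
    and "\<And>x. f x \<le> ess_norm f"
    and "\<And>t x. t \<in> {0<..<1} \<Longrightarrow> x \<in> H \<Longrightarrow>
           section_vol (H\<^sup>\<bottom>) x (upper_level f t) \<le> section_vol (H\<^sup>\<bottom>) 0 (upper_level f t)"
    and "\<And>x. x \<in> H \<Longrightarrow> 0 \<le> g x" and "g \<in> borel_measurable (subspace_lebesgue H)"
    and "radially_decreasing_on H g"
  shows "(\<integral>\<^sup>+x. ennreal (g x * proj_fun H f x) \<partial>subspace_lebesgue H)
           * (\<integral>\<^sup>+y. ennreal (f y) \<partial>subspace_lebesgue (H\<^sup>\<bottom>))
         \<le> ennreal (real (CARD('n) choose k) * ess_norm f)
           * (\<integral>\<^sup>+x. ennreal (g (orth_proj H x) * f x) \<partial>lebesgue)"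
proof -
  have dims: "dim (H\<^sup>\<bottom>) = k" "dim H + k = CARD('n)"
    using dim_orthogonal_comp[OF assms(2)] assms(1,3) by auto
  have "(\<lambda>x. ennreal (g x)) \<in> borel_measurable (subspace_lebesgue H)"
    using assms(10) by simp
  moreover have "ennreal (g x) \<le> ennreal (g (t *\<^sub>R x))" if "x \<in> H" "0 \<le> t" "t \<le> 1" for x t
    using assms(11) that by (intro ennreal_leI) (auto simp: radially_decreasing_on_def)
  moreover have "dim (H\<^sup>\<bottom>) > 0"
    using dims assms(1) by simp
  ultimately have "(\<integral>\<^sup>+x. ennreal (g x) * ennreal (proj_fun H f x) \<partial>subspace_lebesgue H)
           * (\<integral>\<^sup>+y. ennreal (f y) \<partial>subspace_lebesgue (H\<^sup>\<bottom>))
         \<le> ennreal (real (CARD('n) choose k) * ess_norm f)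
           * (\<integral>\<^sup>+x. ennreal (g (orth_proj H x)) * ennreal (f x) \<partial>lebesgue)"
    using quasi_concave_projection_section_inequality[OF assms(2) _ assms(4,7,6), of "\<lambda>x. ennreal (g x)"]
    by (simp add: dims)
  moreover have "(\<integral>\<^sup>+x. ennreal (g x) * ennreal (proj_fun H f x) \<partial>subspace_lebesgue H)
      = (\<integral>\<^sup>+x. ennreal (g x * proj_fun H f x) \<partial>subspace_lebesgue H)"
    using assms(9) by (intro nn_integral_cong) (simp add: ennreal_mult'[symmetric])
  moreover have "(\<integral>\<^sup>+x. ennreal (g (orth_proj H x)) * ennreal (f x) \<partial>lebesgue)
      = (\<integral>\<^sup>+x. ennreal (g (orth_proj H x) * f x) \<partial>lebesgue)"
    using assms(9) orth_proj_in[OF assms(2)] by (simp add: ennreal_mult'[symmetric])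
  ultimately show ?thesis by simp
qed

end
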